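(* Let $f_0\in\mathcal K$ be a probability density on $[0,\infty)$ with $f_0(t)\ne 2(1-t)\mathbf 1_{[0,1]}(t)$ for some $t\in(0,\infty)$ (the alternative hypothesis $\mathcal H_1$). Let $\hat f_n$ be the convex least squares estimator based on $n$ i.i.d. observations from $f_0$, and let $$T_n=\sqrt n\,\sup_{t\in[0,\infty)}\big\{2(1-t)\mathbf 1_{[0,1]}(t)-\hat f_n(t)\big\}.$$ Then for any $\alpha\in(0,1)$, $P(T_n>t_\alpha)\to1$ as $n\to\infty$, where $t_\alpha$ is the upper $\alpha$ quantile of the random variable $T$ defined in the context.
   Context: $\mathcal K$ is the convex cone of all non-negative, continuous, convex and integrable functions on $[0,\infty)$. With $\mathbb F_n$ the empirical distribution function of the observations, the convex LSE is $$\hat f_n=\operatorname*{argmin}_{g\in\mathcal K}\Big(\tfrac12\int_0^\infty g(t)^2dt-\int_0^\infty g(t)\,d\mathbb F_n(t)\Big).$$ Definition of $T$ and $t_\alpha$: let $G(t)=2t-t^2$ on $[0,1]$ (distribution function of the triangular density $2(1-t)\mathbf 1_{[0,1]}(t)$), $\mathbb U$ a standard Brownian bridge on $[0,1]$, $X(t)=\mathbb U(G(t))$, $Y(t)=\int_0^tX(s)ds$. Almost surely there is a unique continuously differentiable $H$ on $[0,1]$ such that: (1) $H\ge Y$ on $[0,1]$; (2) $H$ has convex second derivative on $(0,1)$; (3) $H(0)=Y(0)$, $H'(0)=X(0)$; (4) $H(1)=Y(1)$, $H'(1)=X(1)$; (5) $\int_0^1(H(t)-Y(t))\,dH^{(3)}(t)=0$,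 where $H^{(3)}$ is the left or right derivative of the convex function $H^{(2)}$. Put $T=-\inf_{t\in[0,1]}H^{(2)}(t)$ (values at the endpoints being understood as one-sided limits), and let $t_\alpha$ be the upper $\alpha$ quantile, i.e. the $(1-\alpha)$-quantile, of $T$. (The test rejects the null hypothesis $f_0(t)=2(1-t)\mathbf 1_{[0,1]}(t)$ when $T_n>t_\alpha$.) *)

theory Defs
  imports "HOL-Probability.Probability"
begin

text \<open>Functions on \<open>[0,\<infinity>)\<close> are represented by functions \<open>real \<Rightarrow> real\<close> of which only the
  values on \<^term>\<open>{0::real..}\<close> are ever used.\<close>

definition convex_cone_K :: "(real \<Rightarrow> real) set" where
  "convex_cone_K = {g. (\<forall>t\<ge>0. 0 \<le> g t) \<and> continuous_on {0..} g \<and> convex_on {0..} g \<and>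
                       set_integrable lborel {0..} g}"

definition triangular_density :: "real \<Rightarrow> real" where
  "triangular_density t = 2 * (1 - t) * indicator {0..1} t"

definition triangular_cdf :: "real \<Rightarrow> real" where
  "triangular_cdf t = 2 * t - t\<^sup>2"

definition empirical_cdf :: "nat \<Rightarrow> (nat \<Rightarrow> real) \<Rightarrow> real \<Rightarrow> real" where
  "empirical_cdf n x t = real (card {i. i < n \<and> x i \<le> t}) / real n"

text \<open>Both integrals are finite for \<open>g\<close> in the cone: such a \<open>g\<close> is nonincreasing on
  \<open>[0,\<infinity>)\<close>, hence bounded there and square integrable.\<close>

definition ls_criterion :: "nat \<Rightarrow> (nat \<Rightarrow> real) \<Rightarrow> (real \<Rightarrow> real) \<Rightarrow> real" where
  "ls_criterion n x g =
     1/2 * (LINT t:{0..}|lborel. (g t)\<^sup>2)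
     - (LINT t:{0..}|interval_measure (empirical_cdf n x). g t)"

text \<open>When all observations are positive (hence almost surely, under a density) the minimiser
  exists and its values on \<open>[0,\<infinity>)\<close> are unique; \<^const>\<open>arg_min_on\<close> is a choice of a
  representative. If some observation is \<open>0\<close>, the criterion is unbounded below
  and \<^const>\<open>arg_min_on\<close> returns an unspecified function.\<close>

definition convex_lse :: "nat \<Rightarrow> (nat \<Rightarrow> real) \<Rightarrow> real \<Rightarrow> real" where
  "convex_lse n x = arg_min_on (ls_criterion n x) convex_cone_K"

definition test_statistic :: "nat \<Rightarrow> (nat \<Rightarrow> real) \<Rightarrow> real" where
  "test_statistic n x =
     sqrt (real n) * (SUP t\<in>{0..}. triangular_density t - convex_lse n x t)"

text \<open>Normal laws include the degenerate ones (\<open>\<sigma> = 0\<close>), as is needed for Gaussian processes.\<close>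

definition has_normal_law :: "'a measure \<Rightarrow> ('a \<Rightarrow> real) \<Rightarrow> real \<Rightarrow> real \<Rightarrow> bool" where
  "has_normal_law N Z \<mu> \<sigma> \<longleftrightarrow>
     Z \<in> borel_measurable N \<and> 0 \<le> \<sigma> \<and>
     (if \<sigma> = 0 then (AE \<omega> in N. Z \<omega> = \<mu>)
      else distributed N lborel Z (\<lambda>z. ennreal (normal_density \<mu> \<sigma> z)))"

definition gaussian_process_on :: "'a measure \<Rightarrow> real set \<Rightarrow> (real \<Rightarrow> 'a \<Rightarrow> real) \<Rightarrow> bool" where
  "gaussian_process_on N I U \<longleftrightarrow>
     (\<forall>t\<in>I. U t \<in> borel_measurable N) \<and>
     (\<forall>S c. finite S \<and> S \<subseteq> I \<longrightarrow> (\<exists>\<mu> \<sigma>. has_normal_law N (\<lambda>\<omega>. \<Sum>s\<in>S. c s * U s \<omega>) \<mu> \<sigma>))"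

definition brownian_bridge :: "'a measure \<Rightarrow> (real \<Rightarrow> 'a \<Rightarrow> real) \<Rightarrow> bool" where
  "brownian_bridge N U \<longleftrightarrow>
     prob_space N \<and>
     gaussian_process_on N {0..1} U \<and>
     (\<forall>t\<in>{0..1}. (LINT \<omega>|N. U t \<omega>) = 0) \<and>
     (\<forall>s\<in>{0..1}. \<forall>t\<in>{0..1}. (LINT \<omega>|N. U s \<omega> * U t \<omega>) = min s t - s * t) \<and>
     (AE \<omega> in N. continuous_on {0..1} (\<lambda>t. U t \<omega>))"

text \<open>The Lebesgue-Stieltjes integral over \<open>(0,1)\<close> of a function \<open>g \<ge> 0\<close> with respect to a
  nondecreasing right-continuous \<open>F\<close> on \<open>(0,1)\<close>. As \<open>F\<close> may be unbounded near the
  endpoints, \<open>(0,1)\<close> is exhausted by the intervals \<open>(a,b]\<close> with \<open>a = 1/(k+2)\<close>,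
  \<open>b = 1 - 1/(k+2)\<close>; on each of them \<open>F\<close> is extended constantly to the whole line, so
  that \<^const>\<open>interval_measure\<close> applies.\<close>

definition stieltjes_integral_01 :: "(real \<Rightarrow> real) \<Rightarrow> (real \<Rightarrow> real) \<Rightarrow> ennreal" where
  "stieltjes_integral_01 F g =
     (SUP k::nat. let a = 1 / (real k + 2); b = 1 - 1 / (real k + 2) in
        \<integral>\<^sup>+ t\<in>{a<..b}. ennreal (g t) \<partial>interval_measure (\<lambda>t. F (max a (min b t))))"

text \<open>\<open>H1\<close>, \<open>H2\<close>, \<open>H3\<close> are the first, second and (right) third derivative of \<open>H\<close>.
  In the last clause the endpoints do not matter since \<open>H - Y\<close> vanishes there, and using the
  left derivative would give the same measure on the open interval.\<close>

definition invelope ::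
  "(real \<Rightarrow> real) \<Rightarrow> (real \<Rightarrow> real) \<Rightarrow> (real \<Rightarrow> real) \<Rightarrow> (real \<Rightarrow> real) \<Rightarrow> (real \<Rightarrow> real) \<Rightarrow> (real \<Rightarrow> real)
     \<Rightarrow> bool" where
  "invelope X Y H H1 H2 H3 \<longleftrightarrow>
     (\<forall>t\<in>{0..1}. (H has_real_derivative H1 t) (at t within {0..1})) \<and>
     continuous_on {0..1} H1 \<and>
     (\<forall>t\<in>{0<..<1}. (H1 has_real_derivative H2 t) (at t)) \<and>
     (\<forall>t\<in>{0<..<1}. (H2 has_real_derivative H3 t) (at_right t)) \<and>
     (\<forall>t\<in>{0..1}. Y t \<le> H t) \<and>
     convex_on {0<..<1} H2 \<and>
     H 0 = Y 0 \<and> H1 0 = X 0 \<and>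
     H 1 = Y 1 \<and> H1 1 = X 1 \<and>
     stieltjes_integral_01 H3 (\<lambda>t. H t - Y t) = 0"

text \<open>Extension of a function on \<open>(0,1)\<close> to \<open>[0,1]\<close> by its one-sided limits, which may be infinite.\<close>

definition with_endpoint_limits :: "(real \<Rightarrow> real) \<Rightarrow> real \<Rightarrow> ereal" where
  "with_endpoint_limits h t =
     (if t = 0 then Lim (at_right 0) (\<lambda>s. ereal (h s))
      else if t = 1 then Lim (at_left 1) (\<lambda>s. ereal (h s))
      else ereal (h t))"

text \<open>\<open>T\<close> is a version of the limit variable: \<open>H\<close> exists and is unique on \<open>[0,1]\<close>
  only almost surely, so \<open>T\<close> is determined up to a null set.\<close>

definition limit_variable :: "'a measure \<Rightarrow> (real \<Rightarrow> 'a \<Rightarrow> real) \<Rightarrow> ('a \<Rightarrow> real) \<Rightarrow> bool" where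
  "limit_variable N U T \<longleftrightarrow>
     T \<in> borel_measurable N \<and>
     (AE \<omega> in N.
        let X = (\<lambda>t. U (triangular_cdf t) \<omega>);
            Y = (\<lambda>t. LINT s:{0..t}|lborel. X s)
        in \<exists>H H1 H2 H3. invelope X Y H H1 H2 H3 \<and>
             ereal (T \<omega>) = - (INF t\<in>{0..1}. with_endpoint_limits H2 t))"

definition upper_quantile :: "'a measure \<Rightarrow> ('a \<Rightarrow> real) \<Rightarrow> real \<Rightarrow> real" where
  "upper_quantile N T \<alpha> = Inf {x. 1 - \<alpha> \<le> cdf (distr N borel T) x}"

end

theory Submission
  imports Defs
begin

text \<open>
  The critical value is a fixed number, so it suffices that the supremum of
  \<open>triangular_density - convex_lse\<close> stays above a positive constant with probability tending
  to \<open>1\<close>; the factor \<open>sqrt n\<close> then does the rest. That the estimator cannot lie above the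
  triangular density \<open>p\<close>, up to a small constant, follows from the first-order conditions of the
  least squares problem and one law of large numbers.

  Write \<open>\<langle>g, h\<rangle>\<close> for the integral of \<open>g * h\<close> over \<open>[0, \<infinity>)\<close> and \<open>P\<close> for the empirical mean. The
  estimator \<open>f\<close> satisfies \<open>P g \<le> \<langle>f, g\<rangle>\<close> for all \<open>g\<close> in the cone and \<open>\<langle>f, f\<rangle> = P f\<close>
  (\<open>lse_inner_ge\<close>, \<open>lse_inner_eq\<close>). The part of \<open>f\<close> above a level \<open>c\<close> is in the cone as
  well, so the truncation \<open>min f c\<close> satisfies the reverse inequality \<open>\<langle>min f c, f\<rangle> \<le> P (min f c)\<close>
  (\<open>lse_truncation\<close>); letting \<open>c\<close> tend to \<open>0\<close> shows that \<open>f\<close> has total mass at most \<open>1\<close>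
  (\<open>lse_integral_le_1\<close>). Suppose now that \<open>f \<ge> p - d\<^sup>2\<close> everywhere. Since \<open>p\<close> has mass \<open>1\<close>, \<open>f\<close> is
  close to \<open>p\<close> in the mean, and by monotonicity \<open>min f 2\<close> exceeds \<open>p\<close> by at most a small
  constant at every point. The test function \<open>f0\<close> gives approximately \<open>P f0 \<le> \<langle>p, f0\<rangle>\<close>, and the
  truncation at level \<open>2\<close> gives approximately \<open>\<langle>p, p\<rangle> \<le> P p\<close> (\<open>lse_near_triangular\<close>). By the law of large
  numbers \<open>P (f0 - p)\<close> is close to \<open>\<langle>f0, f0 - p\<rangle>\<close>, so the two inequalities add up to
  \<open>\<langle>f0 - p, f0 - p\<rangle> \<le> small\<close>, which is false for small \<open>d\<close> because \<open>f0\<close> differs from \<open>p\<close>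
  (\<open>lse_falls_short\<close>). Hoeffding's inequality serves as the law of large numbers.

  Two further points need proof. The minimiser exists unless an observation is \<open>0\<close>
  (\<open>lse_exists\<close>): replacing the members of a minimising sequence by maxima of finitely many of
  their supporting lines makes them equi-Lipschitz, and an equi-Lipschitz sequence that is Cauchy
  in the mean square converges at every point. And the event in question is measurable (\<open>test_statistic_borel\<close>): the estimator
  at a point \<open>t > 0\<close> depends continuously on the observations (\<open>continuous_on_convex_lse\<close>).
\<close>

section \<open>Nonnegative integrable convex functions on the half-line\<close>

definition hinge :: "real \<Rightarrow> real \<Rightarrow> real" where
  "hinge z t = max 0 (z - t)"

definition halfline_inner :: "(real \<Rightarrow> real) \<Rightarrow> (real \<Rightarrow> real) \<Rightarrow> real" where
  "halfline_inner g h = (LINT t:{0..}|lborel. g t * h t)"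

lemma cone_nonneg: "g \<in> convex_cone_K \<Longrightarrow> 0 \<le> t \<Longrightarrow> 0 \<le> g t"
  and cone_continuous: "g \<in> convex_cone_K \<Longrightarrow> continuous_on {0..} g"
  and cone_convex: "g \<in> convex_cone_K \<Longrightarrow> convex_on {0..} g"
  and cone_integrable: "g \<in> convex_cone_K \<Longrightarrow> set_integrable lborel {0..} g"
  by (auto simp: convex_cone_K_def)

lemma set_borel_measurable_continuous_halfline:
  fixes g :: "real \<Rightarrow> real"
  assumes "continuous_on {0..} g"
  shows "set_borel_measurable lborel {0..} g"
  using borel_measurable_continuous_on_indicator[OF _ assms]
  by (simp add: set_borel_measurable_def)

lemma set_integrable_const_Icc: "set_integrable lborel {a..b::real} (\<lambda>_. c::real)"
  unfolding set_integrable_def by (intro borel_integrable_compact) auto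

lemma supporting_line:
  fixes g :: "real \<Rightarrow> real"
  assumes "convex_on {0..} g" "0 < p"
  obtains s where "\<And>t. 0 \<le> t \<Longrightarrow> g p + s * (t - p) \<le> g t"
proof
  fix t :: real assume "0 \<le> t"
  then show "g p + Inf ((\<lambda>t. (g p - g t) / (p - t)) ` ({p<..} \<inter> {0..})) * (t - p) \<le> g t"
    using assms by (intro convex_le_Inf_differential) (auto simp: interior_real_atLeast)
qed

text \<open>An increase of a convex function persists along its chord, so it is incompatible with
  integrability.\<close>

lemma cone_antimono:
  assumes g: "g \<in> convex_cone_K" and "0 \<le> s" "s \<le> t"
  shows "g t \<le> g s"
proof (rule ccontr)
  assume less: "\<not> g t \<le> g s"
  with \<open>s \<le> t\<close> have "s < t" by (cases "s = t") auto
  have above: "g t \<le> g u" if "t \<le> u" for u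
  proof (cases "t = u")
    case False
    with that have "t < u" by simp
    have "(g s - g t) / (s - t) \<le> (g s - g u) / (s - u)"
      using convex_on_slope_le(1)[OF cone_convex[OF g], of s u t] assms \<open>s < t\<close> \<open>t < u\<close> by auto
    moreover have "(g s - g u) / (s - u) \<le> (g t - g u) / (t - u)"
      using convex_on_slope_le(2)[OF cone_convex[OF g], of s u t] assms \<open>s < t\<close> \<open>t < u\<close> by auto
    moreover have "0 < (g s - g t) / (s - t)"
      using less \<open>s < t\<close> by (simp add: divide_neg_neg)
    ultimately have "0 < (g t - g u) / (t - u)" by linarith
    then show ?thesis using \<open>t < u\<close> by (simp add: zero_less_divide_iff)
  qed simp
  have pos: "0 < g t" using less cone_nonneg[OF g \<open>0 \<le> s\<close>] by linarith
  define c where "c = (LINT u:{0..}|lborel. g u)"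
  have "g t * real n \<le> c" for n :: nat
  proof -
    have "g t * real n = (LINT u:{t..t + real n}|lborel. g t)"
      by (subst set_integral_const) auto
    also have "\<dots> \<le> (LINT u:{t..t + real n}|lborel. g u)"
      using assms above set_integrable_subset[OF cone_integrable[OF g], of "{t..t + real n}"]
      by (intro set_integral_mono set_integrable_const_Icc) auto
    also have "\<dots> \<le> c"
      unfolding c_def set_lebesgue_integral_def
      using assms cone_integrable[OF g] cone_nonneg[OF g]
        set_integrable_subset[OF cone_integrable[OF g], of "{t..t + real n}"]
      by (intro integral_mono) (auto simp: set_integrable_def indicator_def)
    finally show ?thesis .
  qed
  moreover obtain n :: nat where "c / g t < real n" using reals_Archimedean2 by blast
  ultimately show False using pos
    by (metis mult.commute not_less pos_divide_less_eq)
qed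

lemma cone_le_value_0: "g \<in> convex_cone_K \<Longrightarrow> 0 \<le> t \<Longrightarrow> g t \<le> g 0"
  using cone_antimono[of g 0 t] by simp

lemma cone_add:
  assumes "f \<in> convex_cone_K" "g \<in> convex_cone_K"
  shows "(\<lambda>t. f t + g t) \<in> convex_cone_K"
  using assms by (auto simp: convex_cone_K_def intro!: continuous_intros convex_on_add)

lemma cone_scale:
  assumes "g \<in> convex_cone_K" "0 \<le> c"
  shows "(\<lambda>t. c * g t) \<in> convex_cone_K"
  using assms by (auto simp: convex_cone_K_def intro!: continuous_intros convex_on_cmul)

lemma cone_zero: "(\<lambda>t. 0) \<in> convex_cone_K"
  by (auto simp: convex_cone_K_def convex_on_const set_integrable_def)

lemma convex_on_max:
  fixes f g :: "'a::real_vector \<Rightarrow> real"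
  assumes "convex_on A f" "convex_on A g"
  shows "convex_on A (\<lambda>x. max (f x) (g x))"
proof (rule convex_onI)
  fix t x y assume *: "0 < t" "t < (1::real)" "x \<in> A" "y \<in> A"
  have "f ((1 - t) *\<^sub>R x + t *\<^sub>R y) \<le> (1 - t) * f x + t * f y"
       "g ((1 - t) *\<^sub>R x + t *\<^sub>R y) \<le> (1 - t) * g x + t * g y"
    using * convex_onD[OF assms(1), of t x y] convex_onD[OF assms(2), of t x y] by auto
  moreover have "(1 - t) * f x \<le> (1 - t) * max (f x) (g x)" "t * f y \<le> t * max (f y) (g y)"
                "(1 - t) * g x \<le> (1 - t) * max (f x) (g x)" "t * g y \<le> t * max (f y) (g y)"
    using * by (auto intro!: mult_left_mono)
  ultimately show "max (f ((1 - t) *\<^sub>R x + t *\<^sub>R y)) (g ((1 - t) *\<^sub>R x + t *\<^sub>R y))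
      \<le> (1 - t) * max (f x) (g x) + t * max (f y) (g y)" by linarith
qed (use assms convex_on_imp_convex in auto)

lemma coneI_dominated:
  assumes "\<And>t. 0 \<le> t \<Longrightarrow> 0 \<le> h t" "continuous_on {0..} h" "convex_on {0..} h"
    and "g \<in> convex_cone_K" "\<And>t. 0 \<le> t \<Longrightarrow> h t \<le> g t"
  shows "h \<in> convex_cone_K"
proof -
  have "set_integrable lborel {0..} h"
  proof (rule set_integrable_bound[OF cone_integrable[OF assms(4)]
        set_borel_measurable_continuous_halfline[OF assms(2)]])
    show "AE t in lborel. t \<in> {0..} \<longrightarrow> norm (h t) \<le> norm (g t)"
      using assms(1,5) cone_nonneg[OF assms(4)] by auto
  qed
  with assms(1-3) show ?thesis by (simp add: convex_cone_K_def)
qed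

lemma cone_max:
  assumes "f \<in> convex_cone_K" "g \<in> convex_cone_K"
  shows "(\<lambda>t. max (f t) (g t)) \<in> convex_cone_K"
proof (rule coneI_dominated[OF _ _ _ cone_add[OF assms]])
  show "continuous_on {0..} (\<lambda>t. max (f t) (g t))"
    by (intro continuous_on_max assms cone_continuous)
  show "convex_on {0..} (\<lambda>t. max (f t) (g t))"
    using convex_on_max[OF cone_convex cone_convex] assms by blast
  fix t :: real assume "0 \<le> t"
  then show "0 \<le> max (f t) (g t)" "max (f t) (g t) \<le> f t + g t"
    using cone_nonneg[OF assms(1), of t] cone_nonneg[OF assms(2), of t] by linarith+
qed

lemma cone_hinge: "hinge z \<in> convex_cone_K"
proof -
  have "convex_on {0..} (\<lambda>t::real. z - t)"
    by (rule convex_onI) (auto simp: algebra_simps)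
  moreover have "set_integrable lborel {0..} (hinge z)"
  proof -
    have "set_integrable lborel {0..max 0 z} (hinge z)"
      unfolding set_integrable_def hinge_def
      by (intro borel_integrable_compact) (auto intro!: continuous_intros)
    then show ?thesis
      unfolding set_integrable_def
      by (rule Bochner_Integration.integrable_cong[THEN iffD1, rotated -1])
         (auto simp: hinge_def indicator_def)
  qed
  ultimately show ?thesis
    by (auto simp: convex_cone_K_def hinge_def[abs_def] convex_on_const
        intro!: continuous_intros convex_on_max)
qed

lemma triangular_density_eq_hinge: "0 \<le> t \<Longrightarrow> triangular_density t = 2 * hinge 1 t"
  by (auto simp: triangular_density_def hinge_def indicator_def)

lemma cone_cong:
  assumes "f \<in> convex_cone_K" "\<And>t. 0 \<le> t \<Longrightarrow> g t = f t"
  shows "g \<in> convex_cone_K"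
proof (rule coneI_dominated[OF _ _ _ assms(1)])
  show "continuous_on {0..} g"
    using cone_continuous[OF assms(1)] assms(2) by (subst continuous_on_cong[of _ "{0..}" _ f]) auto
  show "convex_on {0..} g"
    using cone_convex[OF assms(1)] assms(2) by (auto simp: convex_on_def)
qed (use assms cone_nonneg in auto)

lemma cone_triangular: "triangular_density \<in> convex_cone_K"
  using cone_scale[OF cone_hinge, of 2 1] triangular_density_eq_hinge by (auto intro: cone_cong)

text \<open>Truncation at a level destroys convexity, but the part above the level stays convex.
  Statements about a truncation are therefore obtained by subtracting this part.\<close>

lemma cone_part_above:
  assumes "g \<in> convex_cone_K" "0 \<le> c"
  shows "(\<lambda>t. max 0 (g t - c)) \<in> convex_cone_K"
proof (rule coneI_dominated[OF _ _ _ assms(1)])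
  have "convex_on {0..} (\<lambda>t. g t + (- c))"
    by (rule convex_on_add[OF cone_convex[OF assms(1)]]) (simp add: convex_on_const)
  then show "convex_on {0..} (\<lambda>t. max 0 (g t - c))"
    by (intro convex_on_max) (auto simp: convex_on_const)
qed (use assms cone_nonneg cone_continuous in \<open>auto intro!: continuous_intros\<close>)

section \<open>Inner products on the half-line\<close>

lemma product_integrable:
  fixes g h :: "real \<Rightarrow> real"
  assumes "g \<in> convex_cone_K" "continuous_on {0..} h" "\<And>t. 0 \<le> t \<Longrightarrow> \<bar>h t\<bar> \<le> B"
  shows "set_integrable lborel {0..} (\<lambda>t. g t * h t)"
proof (rule set_integrable_bound)
  show "set_integrable lborel {0..} (\<lambda>t. B * g t)" using cone_integrable[OF assms(1)] by simp
  show "set_borel_measurable lborel {0..} (\<lambda>t. g t * h t)"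
    by (intro set_borel_measurable_continuous_halfline continuous_intros assms
        cone_continuous[OF assms(1)])
  show "AE t in lborel. t \<in> {0..} \<longrightarrow> norm (g t * h t) \<le> norm (B * g t)"
  proof (intro AE_I2 impI)
    fix t :: real assume "t \<in> {0..}"
    then have "\<bar>h t\<bar> \<le> B" "0 \<le> g t" using assms(3) cone_nonneg[OF assms(1)] by auto
    then have "\<bar>g t\<bar> * \<bar>h t\<bar> \<le> \<bar>g t\<bar> * \<bar>B\<bar>" by (intro mult_left_mono) auto
    then show "norm (g t * h t) \<le> norm (B * g t)" by (simp add: abs_mult mult.commute)
  qed
qed

lemma cone_product_integrable:
  assumes "g \<in> convex_cone_K" "h \<in> convex_cone_K"
  shows "set_integrable lborel {0..} (\<lambda>t. g t * h t)"
  using product_integrable[OF assms(1) cone_continuous[OF assms(2)], of "h 0"]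
    cone_le_value_0[OF assms(2)] cone_nonneg[OF assms(2)] by simp

lemma inner_commute: "halfline_inner g h = halfline_inner h g"
  by (simp add: halfline_inner_def mult.commute)

lemma inner_add_left:
  assumes "f \<in> convex_cone_K" "g \<in> convex_cone_K" "h \<in> convex_cone_K"
  shows "halfline_inner (\<lambda>t. f t + g t) h = halfline_inner f h + halfline_inner g h"
  using cone_product_integrable[OF assms(1,3)] cone_product_integrable[OF assms(2,3)]
  by (simp add: halfline_inner_def distrib_right)

lemma inner_scale_left: "halfline_inner (\<lambda>t. c * f t) h = c * halfline_inner f h"
  by (simp add: halfline_inner_def mult.assoc)

lemma inner_mono:
  assumes "set_integrable lborel {0..} (\<lambda>t. f t * g t)" "set_integrable lborel {0..} (\<lambda>t. f' t * g' t)"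
    "\<And>t. 0 \<le> t \<Longrightarrow> f t * g t \<le> f' t * g' t"
  shows "halfline_inner f g \<le> halfline_inner f' g'"
  unfolding halfline_inner_def using assms by (intro set_integral_mono) auto

lemma inner_nonneg:
  assumes "f \<in> convex_cone_K" "g \<in> convex_cone_K"
  shows "0 \<le> halfline_inner f g"
  unfolding halfline_inner_def set_lebesgue_integral_def
  using cone_nonneg[OF assms(1)] cone_nonneg[OF assms(2)]
  by (intro Bochner_Integration.integral_nonneg) (auto simp: indicator_def)

lemma cone_diff_square_integrable:
  assumes "f \<in> convex_cone_K" "g \<in> convex_cone_K"
  shows "set_integrable lborel {0..} (\<lambda>t. (f t - g t)\<^sup>2)"
proof -
  have "set_integrable lborel {0..} (\<lambda>t. f t * f t - 2 * (f t * g t) + g t * g t)"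
    using assms by (intro set_integral_add set_integral_diff set_integrable_mult_right
        cone_product_integrable) auto
  then show ?thesis by (simp add: power2_eq_square algebra_simps)
qed

lemma integral_diff_square:
  assumes "f \<in> convex_cone_K" "g \<in> convex_cone_K"
  shows "(LINT t:{0..}|lborel. (f t - g t)\<^sup>2)
    = halfline_inner f f - 2 * halfline_inner f g + halfline_inner g g"
proof -
  have "(LINT t:{0..}|lborel. (f t - g t)\<^sup>2)
      = (LINT t:{0..}|lborel. f t * f t - 2 * (f t * g t) + g t * g t)"
    by (simp add: power2_eq_square algebra_simps)
  also have "\<dots> = halfline_inner f f - 2 * halfline_inner f g + halfline_inner g g"
    using assms unfolding halfline_inner_def
    by (subst set_integral_add(2), (intro set_integral_diff set_integrable_mult_right cone_product_integrable; simp)+)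
       (subst set_integral_diff(2), auto intro!: cone_product_integrable)
  finally show ?thesis .
qed

text \<open>If a Lipschitz function has the value \<open>e\<close> at \<open>t\<close>, then it exceeds \<open>e / 2\<close> on an interval
  of length \<open>e / (2 * L)\<close> to the right of \<open>t\<close>. Smallness in the mean square therefore gives
  smallness at \<open>t\<close>.\<close>

lemma cube_le_of_Lipschitz:
  fixes h :: "real \<Rightarrow> real"
  assumes int: "set_integrable lborel {0..} (\<lambda>t. (h t)\<^sup>2)"
    and Lip: "\<And>s. t \<le> s \<Longrightarrow> \<bar>h s - h t\<bar> \<le> L * (s - t)" and "0 < L" "0 \<le> t"
  shows "\<bar>h t\<bar> ^ 3 \<le> 8 * L * (LINT s:{0..}|lborel. (h s)\<^sup>2)"
proof -
  define e where "e = \<bar>h t\<bar>"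
  define d where "d = e / (2 * L)"
  have "0 \<le> e" "0 \<le> d" using \<open>0 < L\<close> by (auto simp: e_def d_def)
  have half: "(e / 2)\<^sup>2 \<le> (h s)\<^sup>2" if "t \<le> s" "s \<le> t + d" for s
  proof -
    have "L * (s - t) \<le> L * d" using that \<open>0 < L\<close> by simp
    also have "L * d = e / 2" using \<open>0 < L\<close> by (simp add: d_def)
    finally have "\<bar>e / 2\<bar> \<le> \<bar>h s\<bar>" using Lip[OF that(1)] \<open>0 \<le> e\<close> unfolding e_def by linarith
    then show ?thesis by (rule abs_le_square_iff[THEN iffD1])
  qed
  have sub: "set_integrable lborel {t..t + d} (\<lambda>t. (h t)\<^sup>2)"
    using \<open>0 \<le> t\<close> by (intro set_integrable_subset[OF int]) auto
  have "d * (e / 2)\<^sup>2 = (LINT s:{t..t + d}|lborel. (e / 2)\<^sup>2)"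
    using \<open>0 \<le> d\<close> by (subst set_integral_const) auto
  also have "\<dots> \<le> (LINT s:{t..t + d}|lborel. (h s)\<^sup>2)"
    using half sub by (intro set_integral_mono set_integrable_const_Icc) auto
  also have "\<dots> \<le> (LINT s:{0..}|lborel. (h s)\<^sup>2)"
    unfolding set_lebesgue_integral_def using int sub \<open>0 \<le> t\<close>
    by (intro integral_mono) (auto simp: set_integrable_def indicator_def)
  finally show ?thesis using \<open>0 < L\<close>
    by (simp add: d_def e_def[symmetric] field_simps power2_eq_square power3_eq_cube)
qed

text \<open>A member of the cone is on all of \<open>[0, t]\<close> at least as large as at \<open>t\<close>.\<close>

lemma cone_value_le_integral:
  assumes "g \<in> convex_cone_K" "0 \<le> t"
  shows "t * g t \<le> (LINT s:{0..}|lborel. g s)"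
proof -
  have sub: "set_integrable lborel {0..t} g"
    by (intro set_integrable_subset[OF cone_integrable[OF assms(1)]]) auto
  have "t * g t = (LINT s:{0..t}|lborel. g t)"
    using assms by (subst set_integral_const) auto
  also have "\<dots> \<le> (LINT s:{0..t}|lborel. g s)"
    using assms sub cone_antimono[OF assms(1)]
    by (intro set_integral_mono set_integrable_const_Icc) auto
  also have "\<dots> \<le> (LINT s:{0..}|lborel. g s)"
    unfolding set_lebesgue_integral_def using cone_nonneg[OF assms(1)] cone_integrable[OF assms(1)] sub
    by (intro integral_mono) (auto simp: set_integrable_def indicator_def)
  finally show ?thesis .
qed

lemma cone_square_value_le_inner:
  assumes "g \<in> convex_cone_K" "0 \<le> t"
  shows "t * (g t)\<^sup>2 \<le> halfline_inner g g"
proof -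
  have sub: "set_integrable lborel {0..t} (\<lambda>t. g t * g t)"
    by (intro set_integrable_subset[OF cone_product_integrable[OF assms(1) assms(1)]]) auto
  have "t * (g t)\<^sup>2 = (LINT s:{0..t}|lborel. g t * g t)"
    using assms by (subst set_integral_const) (auto simp: power2_eq_square)
  also have "\<dots> \<le> (LINT s:{0..t}|lborel. g s * g s)"
    using assms sub cone_antimono[OF assms(1)] cone_nonneg[OF assms(1)]
    by (intro set_integral_mono set_integrable_const_Icc) (auto intro!: mult_mono)
  also have "\<dots> \<le> halfline_inner g g"
    unfolding halfline_inner_def set_lebesgue_integral_def
    using cone_product_integrable[OF assms(1) assms(1)] sub
    by (intro integral_mono) (auto simp: set_integrable_def indicator_def)
  finally show ?thesis .
qed

text \<open>On \<open>[a, \<infinity>)\<close> a nonincreasing convex function is steepest at \<open>a\<close>, and the slope there is at most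
  the drop over \<open>[a / 2, a]\<close> divided by \<open>a / 2\<close>.\<close>

lemma supporting_slope_bound:
  fixes g :: "real \<Rightarrow> real"
  assumes line: "\<And>t. 0 \<le> t \<Longrightarrow> g p + s * (t - p) \<le> g t"
    and anti: "\<And>s t. 0 \<le> s \<Longrightarrow> s \<le> t \<Longrightarrow> g t \<le> g s" and nonneg: "0 \<le> g p" and p: "0 < a" "a \<le> p"
  shows "s \<le> 0" "- s \<le> 2 * g (a / 2) / a"
proof -
  show "s \<le> 0" using line[of "p + 1"] anti[of p "p + 1"] p by simp
  have "g p + s * (a / 2 - p) \<le> g (a / 2)" using line[of "a / 2"] p by simp
  moreover have "- s * (a / 2) \<le> - s * (p - a / 2)" using p \<open>s \<le> 0\<close> by (intro mult_left_mono) auto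
  ultimately have "- s * (a / 2) \<le> g (a / 2)" using nonneg by (simp add: algebra_simps)
  then show "- s \<le> 2 * g (a / 2) / a" using p by (simp add: field_simps)
qed

lemma cone_Lipschitz:
  assumes g: "g \<in> convex_cone_K" and "0 < t" "t \<le> u" "u \<le> v"
  shows "\<bar>g v - g u\<bar> \<le> 2 * g (t / 2) / t * (v - u)"
proof -
  obtain s where s: "\<And>r. 0 \<le> r \<Longrightarrow> g u + s * (r - u) \<le> g r"
    using supporting_line[OF cone_convex[OF g], of u] assms by auto
  have "- s \<le> 2 * g (t / 2) / t"
    using supporting_slope_bound(2)[of g u s t] s cone_antimono[OF g] cone_nonneg[OF g] assms by auto
  then have "- s * (v - u) \<le> 2 * g (t / 2) / t * (v - u)"
    using assms by (intro mult_right_mono) auto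
  moreover have "g v \<le> g u" using cone_antimono[OF g] assms by auto
  moreover have "g u + s * (v - u) \<le> g v" using s assms by auto
  ultimately show ?thesis by (simp add: algebra_simps)
qed

section \<open>Characterisation of the least squares estimator\<close>

text \<open>Negative points are left out because the integral in the criterion is over \<open>[0, \<infinity>)\<close>.\<close>

definition empirical_mean :: "nat \<Rightarrow> (nat \<Rightarrow> real) \<Rightarrow> (real \<Rightarrow> real) \<Rightarrow> real" where
  "empirical_mean n x g = (\<Sum>i | i < n \<and> 0 \<le> x i. g (x i)) / real n"

lemma interval_measure_empirical_cdf:
  assumes "0 < n"
  shows "interval_measure (empirical_cdf n x) = distr (measure_pmf (pmf_of_set {..<n})) borel x"
proof -
  let ?D = "distr (measure_pmf (pmf_of_set {..<n})) borel x"
  interpret D: real_distribution ?D by (intro prob_space.real_distribution_distr measure_pmf.prob_space_axioms) simp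
  have "cdf ?D t = empirical_cdf n x t" for t
  proof -
    have "cdf ?D t = measure (pmf_of_set {..<n}) (x -` {..t})"
      by (simp add: cdf_def measure_distr)
    also have "\<dots> = real (card ({..<n} \<inter> x -` {..t})) / real n"
      using assms by (subst measure_pmf_of_set) auto
    also have "{..<n} \<inter> x -` {..t} = {i. i < n \<and> x i \<le> t}" by auto
    finally show ?thesis by (simp add: empirical_cdf_def)
  qed
  then have cdf: "empirical_cdf n x = cdf ?D" by auto
  show ?thesis
    unfolding cdf
  proof (rule cdf_unique)
    show "real_distribution (interval_measure (cdf ?D))"
      by (intro real_distribution_interval_measure D.cdf_nondecreasing D.cdf_is_right_cont
          D.cdf_lim_at_bot D.cdf_lim_at_top_prob)
    show "cdf (interval_measure (cdf ?D)) = cdf ?D"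
      by (intro cdf_interval_measure D.cdf_nondecreasing D.cdf_is_right_cont D.cdf_lim_at_bot)
  qed (rule D.real_distribution_axioms)
qed

lemma ls_criterion_eq:
  assumes "0 < n" and g: "g \<in> convex_cone_K"
  shows "ls_criterion n x g = halfline_inner g g / 2 - empirical_mean n x g"
proof -
  let ?P = "measure_pmf (pmf_of_set {..<n})"
  have meas: "(\<lambda>t. indicator {0..} t *\<^sub>R g t) \<in> borel_measurable borel"
    using set_borel_measurable_continuous_halfline[OF cone_continuous[OF g]]
    by (simp add: set_borel_measurable_def)
  have "(LINT t:{0..}|interval_measure (empirical_cdf n x). g t)
      = (\<integral>i. indicator {0..} (x i) *\<^sub>R g (x i) \<partial>?P)"
    unfolding interval_measure_empirical_cdf[OF assms(1)] set_lebesgue_integral_def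
    using meas by (subst integral_distr) auto
  also have "\<dots> = (\<Sum>i<n. indicator {0..} (x i) *\<^sub>R g (x i)) / real n"
    using assms by (subst integral_pmf_of_set) auto
  also have "(\<Sum>i<n. indicator {0..} (x i) *\<^sub>R g (x i)) = (\<Sum>i | i < n \<and> 0 \<le> x i. g (x i))"
    by (intro sum.mono_neutral_cong_right) (auto simp: indicator_def)
  finally show ?thesis
    by (simp add: ls_criterion_def empirical_mean_def halfline_inner_def power2_eq_square)
qed

lemma empirical_mean_add:
  "empirical_mean n x (\<lambda>t. f t + g t) = empirical_mean n x f + empirical_mean n x g"
  by (simp add: empirical_mean_def sum.distrib add_divide_distrib)

lemma empirical_mean_scale: "empirical_mean n x (\<lambda>t. c * f t) = c * empirical_mean n x f"
  by (simp add: empirical_mean_def sum_distrib_left)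

lemma empirical_mean_diff:
  "empirical_mean n x (\<lambda>t. f t - g t) = empirical_mean n x f - empirical_mean n x g"
  by (simp add: empirical_mean_def sum_subtractf diff_divide_distrib)

lemma empirical_mean_mono:
  assumes "\<And>i. i < n \<Longrightarrow> 0 \<le> x i \<Longrightarrow> f (x i) \<le> g (x i)"
  shows "empirical_mean n x f \<le> empirical_mean n x g"
  unfolding empirical_mean_def using assms by (intro divide_right_mono sum_mono) auto

lemma empirical_mean_const_le:
  assumes "0 \<le> c" shows "empirical_mean n x (\<lambda>_. c) \<le> c"
proof -
  have "card {i. i < n \<and> 0 \<le> x i} \<le> card {..<n}" by (intro card_mono) auto
  then have "real (card {i. i < n \<and> 0 \<le> x i}) * c \<le> real n * c"
    using assms by (intro mult_right_mono) auto
  then show ?thesis using assms by (simp add: empirical_mean_def divide_le_eq mult.commute)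
qed

lemma empirical_mean_le:
  assumes "\<And>i. i < n \<Longrightarrow> 0 \<le> x i \<Longrightarrow> f (x i) \<le> c" "0 \<le> c"
  shows "empirical_mean n x f \<le> c"
  using empirical_mean_mono[of n x f "\<lambda>_. c"] empirical_mean_const_le[OF assms(2), of n x] assms
  by force

text \<open>A relation and not a function: a minimiser need not exist, and it is determined only
  on \<open>[0, \<infinity>)\<close>.\<close>

definition is_lse :: "nat \<Rightarrow> (nat \<Rightarrow> real) \<Rightarrow> (real \<Rightarrow> real) \<Rightarrow> bool" where
  "is_lse n x f \<longleftrightarrow> f \<in> convex_cone_K \<and> (\<forall>g\<in>convex_cone_K. ls_criterion n x f \<le> ls_criterion n x g)"

lemma is_lse_cone: "is_lse n x f \<Longrightarrow> f \<in> convex_cone_K"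
  by (simp add: is_lse_def)

lemma is_lse_iff_arg_min: "is_lse n x f \<longleftrightarrow> is_arg_min (ls_criterion n x) (\<lambda>g. g \<in> convex_cone_K) f"
  by (force simp: is_lse_def is_arg_min_def not_less)

lemma convex_lse_eq: "convex_lse n x = (SOME f. is_lse n x f)"
  by (simp add: convex_lse_def arg_min_on_def arg_min_def is_lse_iff_arg_min)

lemma is_lse_convex_lse: "is_lse n x f \<Longrightarrow> is_lse n x (convex_lse n x)"
  unfolding convex_lse_eq by (rule someI[of "is_lse n x"])

text \<open>The derivative of the criterion at the minimiser \<open>f\<close> in the direction of any \<open>g\<close> in the cone is
  nonnegative, since \<open>f + e * g\<close> stays in the cone. In the direction of \<open>f\<close> itself one may move
  both ways, which gives the equality \<open>lse_inner_eq\<close>.\<close>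

lemma lse_inner_ge:
  assumes n: "0 < n" and f: "is_lse n x f" and g: "g \<in> convex_cone_K"
  shows "empirical_mean n x g \<le> halfline_inner f g"
proof (rule ccontr)
  define D where "D = empirical_mean n x g - halfline_inner f g"
  assume "\<not> ?thesis"
  then have "0 < D" by (simp add: D_def)
  define G where "G = halfline_inner g g"
  have "0 \<le> G" unfolding G_def by (intro inner_nonneg g)
  \<comment> \<open>so short a step that the quadratic term \<open>e * e * G / 2\<close> cannot offset the linear gain \<open>e * D\<close>\<close>
  define e where "e = D / (G + 1)"
  have "0 < e" using \<open>0 < D\<close> \<open>0 \<le> G\<close> by (simp add: e_def)
  have fK: "f \<in> convex_cone_K" using f by (rule is_lse_cone)
  have eg: "(\<lambda>t. e * g t) \<in> convex_cone_K" using \<open>0 < e\<close> by (intro cone_scale g) simp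
  define h where "h = (\<lambda>t. f t + e * g t)"
  have h: "h \<in> convex_cone_K" unfolding h_def by (intro cone_add fK eg)
  have "halfline_inner h h = halfline_inner f h + e * halfline_inner g h"
    by (subst (1) h_def) (simp add: inner_add_left fK eg h inner_scale_left)
  also have "halfline_inner f h = halfline_inner f f + e * halfline_inner f g"
    by (subst inner_commute, subst h_def)
       (simp add: inner_add_left fK eg inner_scale_left inner_commute[of g f])
  also have "halfline_inner g h = halfline_inner f g + e * G"
    by (subst inner_commute, subst h_def)
       (simp add: inner_add_left fK g eg inner_scale_left G_def)
  finally have hh: "halfline_inner h h
      = halfline_inner f f + 2 * (e * halfline_inner f g) + e * e * G"
    by (simp add: algebra_simps)
  have "empirical_mean n x h = empirical_mean n x f + e * empirical_mean n x g"
    by (simp add: h_def empirical_mean_add empirical_mean_scale)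
  moreover have "ls_criterion n x f \<le> ls_criterion n x h" using f h by (simp add: is_lse_def)
  ultimately have "e * D \<le> e * (e * G / 2)"
    by (simp add: ls_criterion_eq n fK h hh D_def algebra_simps)
  then have "D \<le> e * G / 2" using \<open>0 < e\<close> by simp
  also have "\<dots> \<le> D / 2"
    using \<open>0 \<le> G\<close> \<open>0 < D\<close> by (simp add: e_def field_simps)
  finally show False using \<open>0 < D\<close> by simp
qed

lemma lse_inner_eq:
  assumes n: "0 < n" and f: "is_lse n x f"
  shows "halfline_inner f f = empirical_mean n x f"
proof (rule antisym)
  have fK: "f \<in> convex_cone_K" using f by (rule is_lse_cone)
  show "empirical_mean n x f \<le> halfline_inner f f" by (rule lse_inner_ge[OF n f fK])
  show "halfline_inner f f \<le> empirical_mean n x f"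
  proof (rule ccontr)
    define F where "F = halfline_inner f f"
    define D where "D = F - empirical_mean n x f"
    assume "\<not> halfline_inner f f \<le> empirical_mean n x f"
    then have "0 < D" by (simp add: D_def F_def)
    have "0 \<le> F" unfolding F_def by (intro inner_nonneg fK)
    \<comment> \<open>a step short enough for \<open>e * F \<le> D\<close>; \<open>e \<le> 1\<close> keeps \<open>(1 - e) * f\<close> in the cone\<close>
    define e where "e = min 1 (D / (F + 1))"
    have e: "0 < e" "e \<le> 1" "e * F \<le> D"
    proof -
      show "0 < e" using \<open>0 < D\<close> \<open>0 \<le> F\<close> by (simp add: e_def)
      have "e * F \<le> D / (F + 1) * F" using \<open>0 \<le> F\<close> by (intro mult_right_mono) (auto simp: e_def)
      also have "\<dots> \<le> D" using \<open>0 < D\<close> \<open>0 \<le> F\<close> by (simp add: field_simps)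
      finally show "e * F \<le> D" .
    qed (simp add: e_def)
    define h where "h = (\<lambda>t. (1 - e) * f t)"
    have h: "h \<in> convex_cone_K" unfolding h_def using e by (intro cone_scale fK) simp
    have "halfline_inner h h = (1 - e) * ((1 - e) * F)"
      unfolding h_def inner_scale_left inner_commute[of f "\<lambda>t. (1 - e) * f t"] F_def ..
    moreover have "empirical_mean n x h = (1 - e) * empirical_mean n x f"
      by (simp add: h_def empirical_mean_scale)
    moreover have "ls_criterion n x f \<le> ls_criterion n x h" using f h by (simp add: is_lse_def)
    ultimately have "e * D \<le> e * (e * F / 2)"
      by (simp add: ls_criterion_eq n fK h D_def F_def[symmetric] algebra_simps)
    then have "D \<le> e * F / 2" using e by simp
    then show False using e \<open>0 < D\<close> by simp
  qed
qed

text \<open>The part of the estimator \<open>f\<close> above a level is in the cone, so \<open>lse_inner_ge\<close> applies to it;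
  subtracting this from the equality \<open>lse_inner_eq\<close> leaves an inequality in the opposite
  direction for the bounded remainder.\<close>

lemma lse_truncation:
  assumes n: "0 < n" and f: "is_lse n x f" and "0 \<le> c"
  shows "halfline_inner (\<lambda>t. min (f t) c) f \<le> empirical_mean n x (\<lambda>t. min (f t) c)"
proof -
  have fK: "f \<in> convex_cone_K" using f by (rule is_lse_cone)
  define g where "g = (\<lambda>t. max 0 (f t - c))"
  have g: "g \<in> convex_cone_K" unfolding g_def by (intro cone_part_above fK assms)
  have split: "min (f t) c = f t - g t" for t by (auto simp: g_def)
  have "halfline_inner (\<lambda>t. min (f t) c) f = halfline_inner f f - halfline_inner f g"
    using cone_product_integrable[OF fK fK] cone_product_integrable[OF g fK]
    unfolding inner_commute[of f g] by (simp add: split halfline_inner_def left_diff_distrib)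
  also have "\<dots> \<le> empirical_mean n x f - empirical_mean n x g"
    using lse_inner_eq[OF n f] lse_inner_ge[OF n f g] by simp
  also have "\<dots> = empirical_mean n x (\<lambda>t. min (f t) c)"
    by (simp add: split empirical_mean_diff)
  finally show ?thesis .
qed

text \<open>Dividing \<open>lse_truncation\<close> by the level \<open>c\<close> and letting \<open>c\<close> tend to \<open>0\<close> turns the truncated
  estimator into the indicator of its support.\<close>

lemma lse_integral_le_1:
  assumes n: "0 < n" and f: "is_lse n x f"
  shows "(LINT t:{0..}|lborel. f t) \<le> 1"
proof -
  have fK: "f \<in> convex_cone_K" using f by (rule is_lse_cone)
  define s where "s k t = indicator {0..} t *\<^sub>R (min (real (Suc k) * f t) 1 * f t)" for k t
  have cont: "continuous_on {0..} (\<lambda>t. min (real (Suc k) * f t) 1 * f t)" for k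
    by (intro continuous_intros cone_continuous[OF fK])
  have "(\<lambda>k. integral\<^sup>L lborel (s k)) \<longlonglongrightarrow> (LINT t|lborel. indicator {0..} t *\<^sub>R f t)"
  proof (rule integral_dominated_convergence)
    show "integrable lborel (\<lambda>t. indicator {0..} t *\<^sub>R f t)"
      using cone_integrable[OF fK] by (simp add: set_integrable_def)
    then show "(\<lambda>t. indicator {0..} t *\<^sub>R f t) \<in> borel_measurable lborel"
      by (rule borel_measurable_integrable)
    show "s k \<in> borel_measurable lborel" for k
      using set_borel_measurable_continuous_halfline[OF cont[of k]]
      unfolding s_def set_borel_measurable_def by simp
    show "AE t in lborel. norm (s k t) \<le> indicator {0..} t *\<^sub>R f t" for k
    proof (intro AE_I2)
      fix t
      show "norm (s k t) \<le> indicator {0..} t *\<^sub>R f t"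
      proof (cases "0 \<le> t")
        case True
        then have "0 \<le> f t" by (rule cone_nonneg[OF fK])
        moreover from this have "0 \<le> min (real (Suc k) * f t) 1" by simp
        ultimately have "min (real (Suc k) * f t) 1 * f t \<le> 1 * f t"
          "0 \<le> min (real (Suc k) * f t) 1 * f t"
          by (intro mult_right_mono mult_nonneg_nonneg; simp)+
        then show ?thesis using True by (simp add: s_def)
      qed (simp add: s_def)
    qed
    show "AE t in lborel. (\<lambda>k. s k t) \<longlonglongrightarrow> indicator {0..} t *\<^sub>R f t"
    proof (intro AE_I2)
      fix t
      show "(\<lambda>k. s k t) \<longlonglongrightarrow> indicator {0..} t *\<^sub>R f t"
      proof (cases "0 \<le> t \<and> f t \<noteq> 0")
        case True
        then have "0 < f t" using cone_nonneg[OF fK, of t] by simp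
        obtain k0 :: nat where k0: "1 / f t < real k0" using reals_Archimedean2 by blast
        have "s k t = indicator {0..} t *\<^sub>R f t" if "k0 \<le> k" for k
        proof -
          have "1 / f t \<le> real (Suc k)" using k0 that by simp
          then have "1 \<le> real (Suc k) * f t" using \<open>0 < f t\<close> by (simp add: field_simps)
          then show ?thesis by (simp add: s_def min_def)
        qed
        then show ?thesis
          by (intro tendsto_eventually eventually_sequentiallyI[of k0]) auto
      next
        case False
        then have "s k t = indicator {0..} t *\<^sub>R f t" for k by (auto simp: s_def)
        then show ?thesis by simp
      qed
    qed
  qed
  moreover have "integral\<^sup>L lborel (s k) \<le> 1" for k
  proof -
    define c where "c = 1 / real (Suc k)"
    have "0 < c" by (simp add: c_def)
    have "min (real (Suc k) * y) 1 = real (Suc k) * min y c" for y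
      by (simp add: c_def min_def field_simps)
    then have "integral\<^sup>L lborel (s k) = real (Suc k) * halfline_inner (\<lambda>t. min (f t) c) f"
      by (simp add: s_def[abs_def] halfline_inner_def set_lebesgue_integral_def mult.assoc
          mult.left_commute[of _ "real (Suc k)"] del: of_nat_Suc)
    also have "\<dots> \<le> real (Suc k) * empirical_mean n x (\<lambda>t. min (f t) c)"
      using lse_truncation[OF n f, of c] \<open>0 < c\<close> by (intro mult_left_mono) auto
    also have "\<dots> \<le> real (Suc k) * c"
      using \<open>0 < c\<close> by (intro mult_left_mono empirical_mean_le) auto
    also have "\<dots> = 1" by (simp add: c_def)
    finally show ?thesis .
  qed
  ultimately have "(LINT t|lborel. indicator {0..} t *\<^sub>R f t) \<le> 1"
    by (intro LIMSEQ_le_const2) auto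
  then show ?thesis by (simp add: set_lebesgue_integral_def)
qed

text \<open>Each of two estimators for different observations is an admissible test function for the
  other one. Adding the two inequalities and the two equalities leaves the squared distance on
  one side and only differences of the two empirical measures on the other.\<close>

lemma lse_distance:
  assumes n: "0 < n" and f: "is_lse n x f" and g: "is_lse n y g"
  shows "(LINT t:{0..}|lborel. (f t - g t)\<^sup>2)
    \<le> (empirical_mean n x f - empirical_mean n y f) - (empirical_mean n x g - empirical_mean n y g)"
proof -
  have K: "f \<in> convex_cone_K" "g \<in> convex_cone_K" using f g by (auto intro: is_lse_cone)
  show ?thesis
    using lse_inner_eq[OF n f] lse_inner_eq[OF n g] lse_inner_ge[OF n f K(2)] lse_inner_ge[OF n g K(1)]
    by (simp add: integral_diff_square[OF K] inner_commute[of g f])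
qed

text \<open>The total mass of a nonincreasing estimator is at most \<open>1\<close>, which bounds its value at \<open>t / 2\<close>
  and hence its slopes on \<open>[t, \<infinity>)\<close>, uniformly in the observations.\<close>

lemma lse_Lipschitz:
  assumes n: "0 < n" and f: "is_lse n x f" and "0 < t" "t \<le> u" "t \<le> v"
  shows "\<bar>f v - f u\<bar> \<le> 4 / t\<^sup>2 * \<bar>v - u\<bar>"
proof -
  have fK: "f \<in> convex_cone_K" using f by (rule is_lse_cone)
  have "t / 2 * f (t / 2) \<le> 1"
    using cone_value_le_integral[OF fK, of "t / 2"] lse_integral_le_1[OF n f] assms by linarith
  then have slope: "2 * f (t / 2) / t \<le> 4 / t\<^sup>2"
    using assms by (simp add: field_simps power2_eq_square)
  have *: "\<bar>f b - f a\<bar> \<le> 4 / t\<^sup>2 * (b - a)" if "t \<le> a" "a \<le> b" for a b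
  proof -
    have "\<bar>f b - f a\<bar> \<le> 2 * f (t / 2) / t * (b - a)"
      using that assms by (intro cone_Lipschitz fK)
    also have "\<dots> \<le> 4 / t\<^sup>2 * (b - a)" using slope that by (intro mult_right_mono) auto
    finally show ?thesis .
  qed
  show ?thesis
    using *[of u v] *[of v u] assms by (cases "u \<le> v") (auto simp: abs_minus_commute)
qed

text \<open>A narrow hinge of height \<open>z\<close> at \<open>0\<close> has an empirical mean of order \<open>z\<close> but an integral of
  order \<open>z\<^sup>2\<close>, which contradicts \<open>lse_inner_ge\<close> for small \<open>z\<close>.\<close>

lemma no_lse_if_observation_0:
  assumes n: "0 < n" and f: "is_lse n x f" and i: "i < n" "x i = 0"
  shows False
proof -
  have fK: "f \<in> convex_cone_K" using f by (rule is_lse_cone)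
  have f0: "0 \<le> f 0" using cone_nonneg[OF fK] by simp
  have "1 / real n \<le> f 0 * z" if "0 < z" for z
  proof -
    have "z / real n \<le> empirical_mean n x (hinge z)"
      unfolding empirical_mean_def
    proof (intro divide_right_mono)
      have "hinge z (x i) \<le> (\<Sum>i | i < n \<and> 0 \<le> x i. hinge z (x i))"
        using i by (intro member_le_sum) (auto simp: hinge_def)
      then show "z \<le> (\<Sum>i | i < n \<and> 0 \<le> x i. hinge z (x i))"
        using i that by (simp add: hinge_def)
    qed simp
    also have "\<dots> \<le> halfline_inner f (hinge z)" by (rule lse_inner_ge[OF n f cone_hinge])
    also have "\<dots> \<le> (LINT t:{0..z}|lborel. f 0 * z)"
      unfolding halfline_inner_def set_lebesgue_integral_def
    proof (rule integral_mono)
      show "integrable lborel (\<lambda>t. indicator {0..} t *\<^sub>R (f t * hinge z t))"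
        using cone_product_integrable[OF fK cone_hinge] by (simp add: set_integrable_def)
      show "integrable lborel (\<lambda>t. indicator {0..z} t *\<^sub>R (f 0 * z))"
        using set_integrable_const_Icc by (simp add: set_integrable_def)
      show "indicator {0..} t *\<^sub>R (f t * hinge z t) \<le> indicator {0..z} t *\<^sub>R (f 0 * z)" for t
        using cone_le_value_0[OF fK, of t] cone_nonneg[OF fK, of t] f0 that
        by (auto simp: indicator_def hinge_def intro!: mult_mono)
    qed
    also have "\<dots> = z * (f 0 * z)" using that by (subst set_integral_const) auto
    finally show ?thesis using that n by (simp add: field_simps)
  qed
  moreover have w: "0 < real n * (f 0 + 1)" using n f0 by simp
  ultimately have "1 / real n \<le> f 0 / (real n * (f 0 + 1))"
    by (metis divide_pos_pos mult.right_neutral times_divide_eq_right zero_less_one)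
  then have "1 / real n * (real n * (f 0 + 1)) \<le> f 0"
    using w by (simp only: pos_le_divide_eq)
  then show False using n by simp
qed

section \<open>Separation from the triangular density\<close>

lemma integral_triangular_density: "(LINT t:{0..}|lborel. triangular_density t) = 1"
proof -
  have "(LINT t:{0..}|lborel. triangular_density t)
      = (\<integral>t. (2 - 2 * t) * indicator {0..1} t \<partial>lborel)"
    unfolding set_lebesgue_integral_def
    by (intro Bochner_Integration.integral_cong) (auto simp: triangular_density_def indicator_def)
  also have "\<dots> = (2 * 1 - 1\<^sup>2) - (2 * 0 - (0::real)\<^sup>2)"
    by (intro integral_FTC_Icc_real)
       (auto intro!: derivative_eq_intros continuous_intros simp: power2_eq_square)
  finally show ?thesis by simp
qed

lemma unit_indicator_integrable:
  "set_integrable lborel {0..} (\<lambda>t::real. c * indicator {0..1} t :: real)"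
  "(LINT t:{0..}|lborel. c * indicator {0..1} (t::real)) = c"
proof -
  have *: "indicator {0..} t *\<^sub>R (indicator {0..1} t :: real) = indicator {0..1} t" for t :: real
    by (auto simp: indicator_def)
  have "integrable lborel (indicator {0..1::real} :: real \<Rightarrow> real)"
    by (rule integrable_real_indicator) auto
  then have "set_integrable lborel {0..} (indicator {0..1} :: real \<Rightarrow> real)"
    unfolding set_integrable_def * .
  then show "set_integrable lborel {0..} (\<lambda>t::real. c * indicator {0..1} t :: real)"
    by (intro set_integrable_mult_right)
  show "(LINT t:{0..}|lborel. c * indicator {0..1} (t::real)) = c"
    unfolding set_integral_mult_right unfolding set_lebesgue_integral_def * by simp
qed

lemma excess_over_triangular_density:
  assumes f: "f \<in> convex_cone_K"
  shows "set_integrable lborel {0..} (\<lambda>t. f t - triangular_density t + c * indicator {0..1} t)"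
    and "(LINT t:{0..}|lborel. f t - triangular_density t + c * indicator {0..1} t)
      = (LINT t:{0..}|lborel. f t) - 1 + c"
proof -
  note int = cone_integrable[OF f] cone_integrable[OF cone_triangular]
  show "set_integrable lborel {0..} (\<lambda>t. f t - triangular_density t + c * indicator {0..1} t)"
    by (intro set_integral_add(1) set_integral_diff(1) int unit_indicator_integrable)
  show "(LINT t:{0..}|lborel. f t - triangular_density t + c * indicator {0..1} t)
      = (LINT t:{0..}|lborel. f t) - 1 + c"
    using int unit_indicator_integrable[of c] set_integral_diff(1)[OF int]
    by (simp only: set_integral_add set_integral_diff integral_triangular_density)
qed

lemma triangular_density_shift:
  assumes "0 \<le> d" "d \<le> t"
  shows "triangular_density (t - d) \<le> triangular_density t + 2 * d"
  using assms by (simp add: triangular_density_eq_hinge hinge_def max_def)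

text \<open>A nonincreasing function is at \<open>t\<close> at most its mean over \<open>[t - d, t]\<close>. A lower bound
  \<open>triangular_density - d\<^sup>2\<close> together with total mass at most \<open>1\<close> controls the mean of the excess over the
  triangular density; near \<open>0\<close>, where this argument gives nothing, the truncation at the
  maximum \<open>2\<close> of the triangular density takes over.\<close>

lemma truncated_lse_le:
  assumes f: "f \<in> convex_cone_K" and mass: "(LINT t:{0..}|lborel. f t) \<le> 1" and "0 < d" "0 \<le> t"
    and lower: "\<And>t. 0 \<le> t \<Longrightarrow> triangular_density t - d\<^sup>2 \<le> f t"
  shows "min (f t) 2 \<le> triangular_density t + 3 * d"
proof (cases "t < d")
  case True
  then have "2 \<le> triangular_density t + 2 * d"
    using \<open>0 \<le> t\<close> by (simp add: triangular_density_eq_hinge hinge_def max_def)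
  then show ?thesis using \<open>0 < d\<close> by linarith
next
  case False
  define r where "r = (\<lambda>t. f t - triangular_density t + d\<^sup>2 * indicator {0..1} t)"
  have r_nonneg: "0 \<le> r t" if "0 \<le> t" for t
    using lower[OF that] cone_nonneg[OF f that]
    by (cases "t \<le> 1") (auto simp: r_def triangular_density_def indicator_def that)
  have r_int: "set_integrable lborel {0..} r"
    unfolding r_def by (rule excess_over_triangular_density(1)[OF f])
  have "(LINT t:{0..}|lborel. r t) = (LINT t:{0..}|lborel. f t) - 1 + d\<^sup>2"
    unfolding r_def by (rule excess_over_triangular_density(2)[OF f])
  then have r_le: "(LINT t:{0..}|lborel. r t) \<le> d\<^sup>2" using mass by simp
  let ?I = "{t - d..t}"
  have sub: "?I \<subseteq> {0..}" using False by auto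
  have int: "set_integrable lborel ?I f" "set_integrable lborel ?I r"
    by (intro set_integrable_subset[OF cone_integrable[OF f] _ sub]
        set_integrable_subset[OF r_int _ sub]; simp)+
  have "d * f t = (LINT s:?I|lborel. f t)"
    using \<open>0 < d\<close> by (subst set_integral_const) auto
  also have "\<dots> \<le> (LINT s:?I|lborel. f s)"
    using False int(1) cone_antimono[OF f] by (intro set_integral_mono set_integrable_const_Icc) auto
  also have "\<dots> \<le> (LINT s:?I|lborel. triangular_density (t - d) + r s)"
  proof (intro set_integral_mono set_integral_add(1) set_integrable_const_Icc int)
    fix s assume "s \<in> ?I"
    then have "triangular_density s \<le> triangular_density (t - d)"
      using False by (intro cone_antimono[OF cone_triangular]) auto
    moreover have "0 \<le> d\<^sup>2 * indicator {0..1} s" by simp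
    ultimately show "f s \<le> triangular_density (t - d) + r s"
      unfolding r_def by linarith
  qed
  also have "\<dots> = d * triangular_density (t - d) + (LINT s:?I|lborel. r s)"
    using int \<open>0 < d\<close> by (subst set_integral_add(2)) (auto intro: set_integrable_const_Icc simp: set_integral_const)
  also have "(LINT s:?I|lborel. r s) \<le> (LINT s:{0..}|lborel. r s)"
    unfolding set_lebesgue_integral_def
  proof (rule integral_mono)
    show "indicator ?I s *\<^sub>R r s \<le> indicator {0..} s *\<^sub>R r s" for s
      using sub r_nonneg[of s] by (auto simp: indicator_def)
  qed (use int(2) r_int in \<open>auto simp: set_integrable_def\<close>)
  also note r_le
  finally have "d * f t \<le> d * (triangular_density (t - d) + d)"
    by (simp add: algebra_simps power2_eq_square)
  then have "f t \<le> triangular_density (t - d) + d" using \<open>0 < d\<close> by simp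
  then show ?thesis using triangular_density_shift[of d t] False \<open>0 < d\<close> by linarith
qed

text \<open>Two tests are combined: the function \<open>g\<close> itself, and the truncation of the estimator at
  level \<open>2\<close>. If the estimator is nowhere much smaller than the triangular density, it is close
  to that density, and the triangular density can replace it in both.\<close>

lemma lse_near_triangular:
  assumes n: "0 < n" and f: "is_lse n x f" and g: "g \<in> convex_cone_K" and d: "0 < d" "d \<le> 1"
    and lower: "\<And>t. 0 \<le> t \<Longrightarrow> triangular_density t - d\<^sup>2 \<le> f t"
  shows "empirical_mean n x (\<lambda>t. g t - triangular_density t)
    \<le> halfline_inner triangular_density g - halfline_inner triangular_density triangular_density
      + (g 0 + 7) * d"
proof -
  let ?p = triangular_density
  have fK: "f \<in> convex_cone_K" using f by (rule is_lse_cone)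
  note mass = lse_integral_le_1[OF n f]
  have g0: "0 \<le> g 0" using cone_nonneg[OF g] by simp
  have dd: "d\<^sup>2 \<le> d" using d by (simp add: power2_eq_square mult_le_cancel_left1)
  have "empirical_mean n x g \<le> halfline_inner f g" by (rule lse_inner_ge[OF n f g])
  also have "\<dots> \<le> (LINT t:{0..}|lborel. ?p t * g t + g 0 * (f t - ?p t + d\<^sup>2 * indicator {0..1} t))"
    unfolding halfline_inner_def
  proof (intro set_integral_mono)
    show "set_integrable lborel {0..} (\<lambda>t. ?p t * g t + g 0 * (f t - ?p t + d\<^sup>2 * indicator {0..1} t))"
      by (intro set_integral_add(1) set_integrable_mult_right cone_product_integrable
          cone_triangular g excess_over_triangular_density fK)
    fix t :: real assume "t \<in> {0..}"
    then have t: "0 \<le> t" by simp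
    have r: "0 \<le> f t - ?p t + d\<^sup>2 * indicator {0..1} t"
      using lower[OF t] cone_nonneg[OF fK t]
      by (cases "t \<le> 1") (auto simp: triangular_density_def indicator_def t)
    have "(f t - ?p t) * g t \<le> (f t - ?p t + d\<^sup>2 * indicator {0..1} t) * g t"
      using cone_nonneg[OF g t] by (intro mult_right_mono) auto
    also have "\<dots> \<le> (f t - ?p t + d\<^sup>2 * indicator {0..1} t) * g 0"
      using cone_le_value_0[OF g t] r by (intro mult_left_mono) auto
    finally show "f t * g t \<le> ?p t * g t + g 0 * (f t - ?p t + d\<^sup>2 * indicator {0..1} t)"
      by (simp add: algebra_simps)
  qed (intro cone_product_integrable fK g)
  also have "\<dots> = halfline_inner ?p g + g 0 * ((LINT t:{0..}|lborel. f t) - 1 + d\<^sup>2)"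
    unfolding halfline_inner_def
    using cone_product_integrable[OF cone_triangular g]
      set_integrable_mult_right[OF excess_over_triangular_density(1)[OF fK, of "d\<^sup>2"], of "g 0"]
    by (simp only: set_integral_add set_integral_mult_right excess_over_triangular_density(2)[OF fK])
  also have "\<dots> \<le> halfline_inner ?p g + g 0 * d"
    using g0 mass dd by (intro add_left_mono mult_left_mono) auto
  finally have first: "empirical_mean n x g \<le> halfline_inner ?p g + g 0 * d" .
  \<comment> \<open>since \<open>?p \<le> 2\<close>, lowering \<open>?p\<close> by \<open>d\<^sup>2\<close> on \<open>[0, 1]\<close> costs at most \<open>4 * d\<^sup>2\<close> in the square;
    with the excess \<open>3 * d\<close> of \<open>truncated_lse_le\<close> this makes up the constant \<open>7\<close>\<close>
  have "halfline_inner ?p ?p - 4 * d\<^sup>2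
      = (LINT t:{0..}|lborel. ?p t * ?p t - 4 * d\<^sup>2 * indicator {0..1} t)"
    unfolding halfline_inner_def
    unfolding set_integral_diff(2)
      [OF cone_product_integrable[OF cone_triangular cone_triangular] unit_indicator_integrable(1)]
      unit_indicator_integrable(2) ..
  also have "\<dots> \<le> halfline_inner (\<lambda>t. min (f t) 2) f"
    unfolding halfline_inner_def
  proof (rule set_integral_mono)
    show "set_integrable lborel {0..} (\<lambda>t. ?p t * ?p t - 4 * d\<^sup>2 * indicator {0..1} t)"
      by (intro set_integral_diff(1) cone_product_integrable cone_triangular unit_indicator_integrable)
    have "set_integrable lborel {0..} (\<lambda>t. f t * min (f t) 2)"
      using cone_nonneg[OF fK]
      by (intro product_integrable[where B = 2] fK continuous_intros cone_continuous[OF fK]) force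
    then show "set_integrable lborel {0..} (\<lambda>t. min (f t) 2 * f t)" by (simp add: mult.commute)
    fix t :: real assume "t \<in> {0..}"
    then have t: "0 \<le> t" by simp
    have p: "0 \<le> ?p t" "?p t \<le> 2" "1 < t \<Longrightarrow> ?p t = 0"
      using t by (auto simp: triangular_density_def indicator_def)
    have ft: "0 \<le> f t" using cone_nonneg[OF fK t] .
    show "?p t * ?p t - 4 * d\<^sup>2 * indicator {0..1} t \<le> min (f t) 2 * f t"
    proof (cases "1 < t")
      case True
      then show ?thesis using ft p by (simp add: indicator_def)
    next
      case False
      then have ind: "indicator {0..1} t = (1::real)" using t by (simp add: indicator_def)
      show ?thesis
      proof (cases "d\<^sup>2 \<le> ?p t")
        case True
        have "(?p t - d\<^sup>2) * (?p t - d\<^sup>2) \<le> min (f t) 2 * f t"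
        proof (rule mult_mono)
          have "0 \<le> d\<^sup>2" by simp
          then show "?p t - d\<^sup>2 \<le> min (f t) 2" using lower[OF t] p(2) by linarith
        qed (use lower[OF t] True ft in auto)
        moreover have "?p t * d\<^sup>2 \<le> 2 * d\<^sup>2" using p by (intro mult_right_mono) auto
        moreover have "(?p t - d\<^sup>2) * (?p t - d\<^sup>2) = ?p t * ?p t - 2 * (?p t * d\<^sup>2) + d\<^sup>2 * d\<^sup>2"
          by (simp add: algebra_simps)
        moreover have "0 \<le> d\<^sup>2 * d\<^sup>2" by simp
        ultimately show ?thesis unfolding ind by linarith
      next
        case False
        have "?p t * ?p t \<le> 2 * d\<^sup>2" using p False by (intro mult_mono) auto
        moreover have "0 \<le> min (f t) 2 * f t" using ft by simp
        moreover have "0 \<le> d\<^sup>2" by simp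
        ultimately show ?thesis unfolding ind by linarith
      qed
    qed
  qed
  also have "\<dots> \<le> empirical_mean n x (\<lambda>t. min (f t) 2)" by (rule lse_truncation[OF n f]) simp
  also have "\<dots> \<le> empirical_mean n x (\<lambda>t. ?p t + 3 * d)"
    using truncated_lse_le[OF fK mass d(1) _ lower] by (intro empirical_mean_mono)
  also have "\<dots> \<le> empirical_mean n x ?p + 3 * d"
    using d empirical_mean_const_le[of "3 * d" n x] by (simp add: empirical_mean_add)
  finally have second: "halfline_inner ?p ?p - 4 * d\<^sup>2 \<le> empirical_mean n x ?p + 3 * d" .
  have "4 * d\<^sup>2 + 3 * d + g 0 * d \<le> (g 0 + 7) * d"
    using dd by (simp add: algebra_simps)
  then show ?thesis
    unfolding empirical_mean_diff using first second by linarith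
qed

section \<open>Existence of the estimator\<close>

text \<open>If the observations stay at distance \<open>a\<close> from \<open>0\<close>, the linear part of the criterion is at
  most \<open>g a\<close>, which grows only like the norm of \<open>g\<close>.\<close>

lemma ls_criterion_coercive:
  assumes n: "0 < n" and "0 < a" and a: "\<And>i. i < n \<Longrightarrow> 0 \<le> x i \<Longrightarrow> a \<le> x i"
    and g: "g \<in> convex_cone_K"
  shows "halfline_inner g g \<le> 4 * ls_criterion n x g + 4 / a"
proof -
  have ga: "0 \<le> g a" using cone_nonneg[OF g] \<open>0 < a\<close> by simp
  have "empirical_mean n x g \<le> g a"
    using a ga \<open>0 < a\<close> by (intro empirical_mean_le cone_antimono[OF g]) auto
  moreover have "g a \<le> a * (g a)\<^sup>2 / 4 + 1 / a"
  proof -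
    have "0 \<le> (a * g a - 2)\<^sup>2" by simp
    then show ?thesis using \<open>0 < a\<close> by (simp add: field_simps power2_eq_square)
  qed
  moreover have "a * (g a)\<^sup>2 \<le> halfline_inner g g"
    using cone_square_value_le_inner[OF g] \<open>0 < a\<close> by simp
  ultimately show ?thesis by (simp add: ls_criterion_eq[OF n g])
qed

text \<open>The strict convexity of the quadratic part makes every minimising sequence Cauchy in the
  mean square.\<close>

lemma ls_criterion_parallelogram:
  assumes n: "0 < n" and f: "f \<in> convex_cone_K" and g: "g \<in> convex_cone_K"
    and m: "\<And>h. h \<in> convex_cone_K \<Longrightarrow> m \<le> ls_criterion n x h"
  shows "(LINT t:{0..}|lborel. (f t - g t)\<^sup>2)
    \<le> 4 * ((ls_criterion n x f - m) + (ls_criterion n x g - m))"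
proof -
  define h where "h = (\<lambda>t. f t + g t)"
  have h: "h \<in> convex_cone_K" unfolding h_def by (intro cone_add f g)
  have h2: "(\<lambda>t. 1/2 * h t) \<in> convex_cone_K" by (intro cone_scale h) simp
  have hf: "halfline_inner h k = halfline_inner f k + halfline_inner g k"
    if "k \<in> convex_cone_K" for k
    unfolding h_def by (rule inner_add_left[OF f g that])
  have fh: "halfline_inner f h = halfline_inner f f + halfline_inner f g"
    using hf[OF f] by (simp add: inner_commute[of f h] inner_commute[of f g])
  have gh: "halfline_inner g h = halfline_inner f g + halfline_inner g g"
    using hf[OF g] by (simp add: inner_commute[of g h])
  have hh: "halfline_inner h h = halfline_inner f h + halfline_inner g h"
    by (rule hf[OF h])
  have half: "halfline_inner (\<lambda>t. 1/2 * h t) (\<lambda>t. 1/2 * h t) = 1/2 * (1/2 * halfline_inner h h)"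
    unfolding inner_scale_left inner_commute[of h "\<lambda>t. 1/2 * h t"] ..
  have mean: "empirical_mean n x (\<lambda>t. 1/2 * h t) = 1/2 * (empirical_mean n x f + empirical_mean n x g)"
    unfolding empirical_mean_scale by (simp add: h_def empirical_mean_add)
  have "ls_criterion n x (\<lambda>t. 1/2 * h t)
      = (halfline_inner f f + 2 * halfline_inner f g + halfline_inner g g) / 8
        - (empirical_mean n x f + empirical_mean n x g) / 2"
    unfolding ls_criterion_eq[OF n h2] half mean hh fh gh by (simp add: field_simps)
  then have "m \<le> (halfline_inner f f + 2 * halfline_inner f g + halfline_inner g g) / 8
        - (empirical_mean n x f + empirical_mean n x g) / 2"
    using m[OF h2] by (rule ord_le_eq_trans[rotated])
  then show ?thesis
    unfolding integral_diff_square[OF f g] ls_criterion_eq[OF n f] ls_criterion_eq[OF n g]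
    by argo
qed

text \<open>The maximum of finitely many supporting lines and \<open>0\<close> keeps the values at the points of
  contact and has the slopes of the lines as Lipschitz constant, also at \<open>0\<close>. It has bounded
  support because a function that comes arbitrarily close to \<open>0\<close> has no horizontal supporting
  line at a point where it is positive.\<close>

lemma polygonal_minorant:
  fixes g :: "real \<Rightarrow> real"
  assumes convex: "convex_on {0..} g" and anti: "\<And>s t. 0 \<le> s \<Longrightarrow> s \<le> t \<Longrightarrow> g t \<le> g s"
    and nonneg: "\<And>t. 0 \<le> t \<Longrightarrow> 0 \<le> g t"
    and vanishing: "\<And>e. 0 < e \<Longrightarrow> \<exists>t\<ge>0. g t < e"
    and "finite P" and P: "\<And>p. p \<in> P \<Longrightarrow> a \<le> p" and "0 < a" and L: "2 * g (a / 2) / a \<le> L"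
  shows "\<exists>u\<in>convex_cone_K. (\<forall>t\<ge>0. u t \<le> g t) \<and> (\<forall>p\<in>P. u p = g p) \<and>
    (\<forall>s\<ge>0. \<forall>t\<ge>s. \<bar>u t - u s\<bar> \<le> L * (t - s))"
  using \<open>finite P\<close> P
proof (induction P rule: finite_induct)
  case empty
  have "0 \<le> 2 * g (a / 2) / a" using nonneg[of "a / 2"] \<open>0 < a\<close> by simp
  then have "0 \<le> L" using L by simp
  then show ?case using nonneg by (intro bexI[OF _ cone_zero]) auto
next
  case (insert p P)
  then obtain u where u: "u \<in> convex_cone_K" "\<forall>t\<ge>0. u t \<le> g t" "\<forall>p\<in>P. u p = g p"
    "\<forall>s\<ge>0. \<forall>t\<ge>s. \<bar>u t - u s\<bar> \<le> L * (t - s)"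
    by auto
  have p: "a \<le> p" "0 < p" using insert.prems[of p] \<open>0 < a\<close> by auto
  obtain s where line: "\<And>t. 0 \<le> t \<Longrightarrow> g p + s * (t - p) \<le> g t"
    using supporting_line[OF convex p(2)] by blast
  have gp: "0 \<le> g p" using nonneg p by simp
  note s = supporting_slope_bound[of g p s, OF line anti gp \<open>0 < a\<close> p(1)]
  define h where "h = (\<lambda>t. max 0 (g p + s * (t - p)))"
  have hg: "h t \<le> g t" if "0 \<le> t" for t using line[OF that] nonneg[OF that] by (simp add: h_def)
  have h: "h \<in> convex_cone_K"
  proof (cases "s = 0")
    case True
    have "g p = 0"
    proof (rule ccontr)
      assume "g p \<noteq> 0"
      then obtain t where "0 \<le> t" "g t < g p" using vanishing[of "g p"] gp by force
      then show False using line[of t] True by simp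
    qed
    then show ?thesis using True by (simp add: h_def cone_zero)
  next
    case False
    with s(1) have "s < 0" by simp
    have "h t = - s * hinge (p - g p / s) t" for t
    proof -
      have eq: "g p + s * (t - p) = - s * (p - g p / s - t)"
        using \<open>s < 0\<close> by (simp add: field_simps)
      have "max 0 (- s * y) = - s * max 0 y" for y
        using \<open>s < 0\<close> by (simp add: max_def mult_le_0_iff)
      then show ?thesis unfolding h_def hinge_def eq .
    qed
    then show ?thesis using s(1) by (intro cone_cong[OF cone_scale[OF cone_hinge, of "- s"]]) simp
  qed
  have Lip: "\<bar>h t - h r\<bar> \<le> L * (t - r)" if "0 \<le> r" "r \<le> t" for r t
  proof -
    have "- s * (t - r) \<le> L * (t - r)" using s(2) L that by (intro mult_right_mono) auto
    moreover have "0 \<le> - s * (t - r)" using s(1) that by (intro mult_nonneg_nonneg) auto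
    moreover have "s * (t - p) = s * (r - p) - (- s * (t - r))" by (simp add: algebra_simps)
    ultimately show ?thesis unfolding h_def by linarith
  qed
  show ?case
  proof (intro bexI conjI ballI allI impI)
    show "(\<lambda>t. max (u t) (h t)) \<in> convex_cone_K" by (rule cone_max[OF u(1) h])
    show "max (u t) (h t) \<le> g t" if "0 \<le> t" for t using u(2) hg that by simp
    show "max (u q) (h q) = g q" if "q \<in> insert p P" for q
    proof (cases "q = p")
      case True
      have "h p = g p" using gp by (simp add: h_def)
      then show ?thesis using True u(2) p by (simp add: max_absorb2)
    next
      case False
      then have "q \<in> P" using that by simp
      then have "u q = g q" "h q \<le> g q" using u(3) hg[of q] insert.prems[of q] \<open>0 < a\<close> by auto
      then show ?thesis by simp
    qed
    show "\<bar>max (u t) (h t) - max (u r) (h r)\<bar> \<le> L * (t - r)" if "0 \<le> r" "r \<le> t" for r t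
    proof -
      have "\<bar>u t - u r\<bar> \<le> L * (t - r)" using u(4) that by auto
      then show ?thesis using Lip[OF that] by linarith
    qed
  qed
qed

lemma cone_vanishing:
  assumes g: "g \<in> convex_cone_K" and "0 < e"
  shows "\<exists>t\<ge>0. g t < e"
proof -
  define I where "I = (LINT t:{0..}|lborel. g t)"
  have "0 \<le> I" using cone_value_le_integral[OF g, of 0] by (simp add: I_def)
  define t where "t = I / e + 1"
  have t: "0 < t" using \<open>0 \<le> I\<close> \<open>0 < e\<close> by (simp add: t_def add_nonneg_pos)
  have "t * g t \<le> I" using cone_value_le_integral[OF g, of t] t by (simp add: I_def)
  also have "I < t * e" using \<open>0 < e\<close> by (simp add: t_def field_simps)
  finally show ?thesis using t by (intro exI[of _ t]) simp
qed

lemma ls_criterion_le_of_minorant: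
  assumes n: "0 < n" and u: "u \<in> convex_cone_K" and g: "g \<in> convex_cone_K"
    and le: "\<And>t. 0 \<le> t \<Longrightarrow> u t \<le> g t" and eq: "\<And>i. i < n \<Longrightarrow> 0 \<le> x i \<Longrightarrow> u (x i) = g (x i)"
  shows "ls_criterion n x u \<le> ls_criterion n x g"
proof -
  have "halfline_inner u u \<le> halfline_inner g g"
    using le cone_nonneg[OF u] cone_nonneg[OF g]
    by (intro inner_mono cone_product_integrable u g mult_mono) auto
  moreover have "empirical_mean n x u = empirical_mean n x g"
    using eq by (simp add: empirical_mean_def)
  ultimately show ?thesis by (simp add: ls_criterion_eq[OF n u] ls_criterion_eq[OF n g])
qed

text \<open>Lower semicontinuity of the norm along a pointwise convergent sequence. The functions
  \<open>min (u k) w\<close> lie below \<open>u k\<close> and converge to \<open>w\<close>, dominated by \<open>w\<close>.\<close>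

lemma inner_le_of_pointwise_limit:
  assumes u: "\<And>k. u k \<in> convex_cone_K" and w: "w \<in> convex_cone_K"
    and lim: "\<And>t. 0 \<le> t \<Longrightarrow> (\<lambda>k. u k t) \<longlonglongrightarrow> v t" and le: "\<And>t. 0 \<le> t \<Longrightarrow> w t \<le> v t"
    and c: "c \<longlonglongrightarrow> C" "\<And>k. halfline_inner (u k) (u k) \<le> c k"
  shows "halfline_inner w w \<le> C"
proof -
  define s where "s k t = indicator {0..} t *\<^sub>R (min (u k t) (w t) * min (u k t) (w t))" for k t
  have cont: "continuous_on {0..} (\<lambda>t. min (u k t) (w t) * min (u k t) (w t))" for k
    by (intro continuous_intros cone_continuous u w)
  have dom: "integrable lborel (\<lambda>t. indicator {0..} t *\<^sub>R (w t * w t))"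
    using cone_product_integrable[OF w w] by (simp add: set_integrable_def)
  have meas: "s k \<in> borel_measurable lborel" for k
    using set_borel_measurable_continuous_halfline[OF cont[of k]]
    by (simp add: s_def[abs_def] set_borel_measurable_def)
  have s: "norm (s k t) \<le> indicator {0..} t *\<^sub>R (w t * w t)"
    "s k t \<le> indicator {0..} t *\<^sub>R (u k t * u k t)" for k t
  proof -
    have "0 \<le> min (u k t) (w t)" if "0 \<le> t"
      using cone_nonneg[OF u that] cone_nonneg[OF w that] by simp
    then have "min (u k t) (w t) * min (u k t) (w t) \<le> w t * w t"
      "min (u k t) (w t) * min (u k t) (w t) \<le> u k t * u k t" if "0 \<le> t"
      using that by (intro mult_mono; force)+
    then show "norm (s k t) \<le> indicator {0..} t *\<^sub>R (w t * w t)"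
      "s k t \<le> indicator {0..} t *\<^sub>R (u k t * u k t)"
      by (auto simp: s_def indicator_def)
  qed
  have int: "integrable lborel (s k)" for k
    using s(1) by (intro Bochner_Integration.integrable_bound[OF dom meas]) (auto intro!: AE_I2 order_trans[OF s(1)])
  have "(\<lambda>k. integral\<^sup>L lborel (s k)) \<longlonglongrightarrow> (LINT t|lborel. indicator {0..} t *\<^sub>R (w t * w t))"
  proof (rule integral_dominated_convergence[OF _ meas dom])
    show "(\<lambda>t. indicator {0..} t *\<^sub>R (w t * w t)) \<in> borel_measurable lborel"
      using dom by (rule borel_measurable_integrable)
    show "AE t in lborel. (\<lambda>k. s k t) \<longlonglongrightarrow> indicator {0..} t *\<^sub>R (w t * w t)"
    proof (intro AE_I2)
      fix t
      show "(\<lambda>k. s k t) \<longlonglongrightarrow> indicator {0..} t *\<^sub>R (w t * w t)"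
      proof (cases "0 \<le> t")
        case True
        have "(\<lambda>k. min (u k t) (w t)) \<longlonglongrightarrow> min (v t) (w t)"
          by (intro tendsto_min lim True tendsto_const)
        then have "(\<lambda>k. min (u k t) (w t)) \<longlonglongrightarrow> w t" using le[OF True] by (simp add: min_absorb2)
        then have "(\<lambda>k. min (u k t) (w t) * min (u k t) (w t)) \<longlonglongrightarrow> w t * w t"
          by (intro tendsto_mult)
        then show ?thesis using True by (simp add: s_def)
      qed (simp add: s_def)
    qed
  qed (use s(1) in auto)
  moreover have "integral\<^sup>L lborel (s k) \<le> c k" for k
  proof -
    have "integral\<^sup>L lborel (s k) \<le> halfline_inner (u k) (u k)"
      unfolding halfline_inner_def set_lebesgue_integral_def
      using s(2) int cone_product_integrable[OF u u, of k k]
      by (intro integral_mono) (auto simp: set_integrable_def)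
    with c(2)[of k] show ?thesis by simp
  qed
  ultimately show ?thesis
    unfolding halfline_inner_def set_lebesgue_integral_def
    using c(1) by (intro LIMSEQ_le[of "\<lambda>k. integral\<^sup>L lborel (s k)" _ c]) auto
qed

text \<open>A minimising sequence of polygonal functions is equi-Lipschitz and Cauchy in the mean square,
  hence convergent at each point. The limit need not be integrable, but its polygonal minorant
  is, and it does not increase the criterion.\<close>

lemma lse_exists:
  assumes n: "0 < n" and nonzero: "\<And>i. i < n \<Longrightarrow> x i \<noteq> 0"
  shows "\<exists>f. is_lse n x f"
proof -
  define P where "P = x ` {i. i < n \<and> 0 \<le> x i}"
  define a where "a = Min (insert 1 P)"
  have "finite P" by (simp add: P_def)
  have pos: "0 < p" if "p \<in> P" for p using that nonzero unfolding P_def by force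
  have "0 < a" using \<open>finite P\<close> pos by (simp add: a_def)
  have a: "a \<le> p" if "p \<in> P" for p using that \<open>finite P\<close> by (simp add: a_def)
  have a': "a \<le> x i" if "i < n" "0 \<le> x i" for i using a that by (auto simp: P_def)
  let ?Q = "ls_criterion n x"
  have coercive: "halfline_inner g g \<le> 4 * ?Q g + 4 / a" if "g \<in> convex_cone_K" for g
    using ls_criterion_coercive[OF n \<open>0 < a\<close> _ that, of x] a' by blast
  have bound: "- 1 / a \<le> ?Q g" if "g \<in> convex_cone_K" for g
    using coercive[OF that] inner_nonneg[OF that that] by simp
  define m where "m = (INF g\<in>convex_cone_K. ?Q g)"
  have bdd: "bdd_below (?Q ` convex_cone_K)" using bound by (auto intro!: bdd_belowI2)
  have m: "m \<le> ?Q g" if "g \<in> convex_cone_K" for g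
    unfolding m_def by (rule cINF_lower[OF bdd that])
  have "?Q (\<lambda>_. 0) = 0"
    by (simp add: ls_criterion_eq[OF n cone_zero] halfline_inner_def empirical_mean_def)
  then have "m \<le> 0" using m[OF cone_zero] by simp
  \<comment> \<open>\<open>R\<close> bounds the squared norm of every \<open>g\<close> with criterion at most \<open>1\<close>, and \<open>L\<close> the slope
    of such a \<open>g\<close> on \<open>[a, \<infinity>)\<close>; the summand \<open>1\<close> only makes \<open>L\<close> positive\<close>
  define R where "R = 4 + 4 / a"
  define L where "L = 2 * sqrt (2 * R / a) / a + 1"
  have "0 < R" using \<open>0 < a\<close> by (simp add: R_def add_pos_pos)
  have "0 < L" using \<open>0 < a\<close> \<open>0 < R\<close> by (simp add: L_def add_nonneg_pos)
  have "\<exists>u\<in>convex_cone_K. ?Q u < m + 1 / real (Suc k) \<and>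
      (\<forall>s\<ge>0. \<forall>t\<ge>s. \<bar>u t - u s\<bar> \<le> L * (t - s))" for k
  proof -
    have "\<exists>g\<in>convex_cone_K. ?Q g < m + 1 / real (Suc k)"
      using cINF_less_iff[OF _ bdd, of "m + 1 / real (Suc k)"] cone_zero by (auto simp: m_def)
    then obtain g where g: "g \<in> convex_cone_K" "?Q g < m + 1 / real (Suc k)" by blast
    have "1 / real (Suc k) \<le> 1" by simp
    with g(2) \<open>m \<le> 0\<close> have "?Q g \<le> 1" by linarith
    then have "halfline_inner g g \<le> R" using coercive[OF g(1)] by (simp add: R_def)
    then have "a / 2 * (g (a / 2))\<^sup>2 \<le> R"
      using cone_square_value_le_inner[OF g(1), of "a / 2"] \<open>0 < a\<close> by simp
    then have "(g (a / 2))\<^sup>2 \<le> 2 * R / a" using \<open>0 < a\<close> by (simp add: field_simps)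
    then have "g (a / 2) \<le> sqrt (2 * R / a)" by (rule real_le_rsqrt)
    then have "2 * g (a / 2) / a \<le> 2 * sqrt (2 * R / a) / a"
      using \<open>0 < a\<close> by (intro divide_right_mono mult_left_mono) auto
    then have "2 * g (a / 2) / a \<le> L" by (simp add: L_def)
    from polygonal_minorant[OF cone_convex[OF g(1)] cone_antimono[OF g(1)] cone_nonneg[OF g(1)]
        cone_vanishing[OF g(1)] \<open>finite P\<close> a \<open>0 < a\<close> this]
    obtain u where u: "u \<in> convex_cone_K" "\<forall>t\<ge>0. u t \<le> g t" "\<forall>p\<in>P. u p = g p"
      "\<forall>s\<ge>0. \<forall>t\<ge>s. \<bar>u t - u s\<bar> \<le> L * (t - s)" by blast
    have "?Q u \<le> ?Q g"
      using u by (intro ls_criterion_le_of_minorant n g(1)) (auto simp: P_def)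
    then show ?thesis using u g(2) by (intro bexI[of _ u]) auto
  qed
  then obtain u where uK: "\<And>k. u k \<in> convex_cone_K"
    and uQ: "\<And>k. ?Q (u k) < m + 1 / real (Suc k)"
    and uL: "\<And>k s t. 0 \<le> s \<Longrightarrow> s \<le> t \<Longrightarrow> \<bar>u k t - u k s\<bar> \<le> L * (t - s)"
    by metis
  have diff: "\<bar>u j t - u k t\<bar> ^ 3 \<le> 64 * L * (1 / real (Suc j) + 1 / real (Suc k))"
    if "0 \<le> t" for j k t
  proof -
    have "\<bar>u j t - u k t\<bar> ^ 3 \<le> 8 * (2 * L) * (LINT s:{0..}|lborel. (u j s - u k s)\<^sup>2)"
    proof (rule cube_le_of_Lipschitz)
      show "set_integrable lborel {0..} (\<lambda>s. (u j s - u k s)\<^sup>2)"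
        by (intro cone_diff_square_integrable uK)
      show "\<bar>u j s - u k s - (u j t - u k t)\<bar> \<le> 2 * L * (s - t)" if "t \<le> s" for s
        using uL[OF \<open>0 \<le> t\<close> that, of j] uL[OF \<open>0 \<le> t\<close> that, of k] by linarith
    qed (use \<open>0 < L\<close> that in auto)
    also have "\<dots> \<le> 8 * (2 * L) * (4 * (1 / real (Suc j) + 1 / real (Suc k)))"
    proof (rule mult_left_mono)
      show "(LINT s:{0..}|lborel. (u j s - u k s)\<^sup>2) \<le> 4 * (1 / real (Suc j) + 1 / real (Suc k))"
      proof -
        have "(LINT s:{0..}|lborel. (u j s - u k s)\<^sup>2) \<le> 4 * ((?Q (u j) - m) + (?Q (u k) - m))"
          by (rule ls_criterion_parallelogram[OF n uK uK]) (rule m)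
        also have "\<dots> \<le> 4 * (1 / real (Suc j) + 1 / real (Suc k))"
          using less_imp_le[OF uQ[of j]] less_imp_le[OF uQ[of k]]
          by (intro mult_left_mono add_mono) (auto simp: le_diff_eq diff_le_eq add.commute)
        finally show ?thesis .
      qed
    qed (use \<open>0 < L\<close> in simp)
    also have "\<dots> = 64 * L * (1 / real (Suc j) + 1 / real (Suc k))"
      by (simp only: distrib_left)
    finally show ?thesis .
  qed
  have "convergent (\<lambda>k. u k t)" if "0 \<le> t" for t
  proof (rule real_Cauchy_convergent, rule metric_CauchyI)
    fix e :: real assume "0 < e"
    obtain N :: nat where N: "128 * L / e ^ 3 < real N" using reals_Archimedean2 by blast
    have "dist (u j t) (u k t) < e" if "N \<le> j" "N \<le> k" for j k
    proof -
      have "0 < real (Suc N)" "real (Suc N) \<le> real (Suc j)" "real (Suc N) \<le> real (Suc k)"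
        using that by auto
      then have "1 / real (Suc j) \<le> 1 / real (Suc N)" "1 / real (Suc k) \<le> 1 / real (Suc N)"
        by (auto intro!: divide_left_mono)
      then have "64 * L * (1 / real (Suc j) + 1 / real (Suc k)) \<le> 64 * L * (2 * (1 / real (Suc N)))"
        using \<open>0 < L\<close> by (intro mult_left_mono) auto
      also have "\<dots> < e ^ 3"
      proof -
        have "128 * L < real (Suc N) * e ^ 3"
          using N \<open>0 < e\<close> by (simp add: field_simps add_strict_increasing2)
        then show ?thesis by (simp add: field_simps)
      qed
      finally have "\<bar>u j t - u k t\<bar> ^ 3 < e ^ 3" using diff[OF \<open>0 \<le> t\<close>, of j k] by linarith
      then show ?thesis
        using \<open>0 < e\<close> by (simp add: dist_real_def power_less_imp_less_base)
    qed
    then show "\<exists>N. \<forall>j\<ge>N. \<forall>k\<ge>N. dist (u j t) (u k t) < e" by blast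
  qed
  define v where "v t = lim (\<lambda>k. u k t)" for t
  have v: "(\<lambda>k. u k t) \<longlonglongrightarrow> v t" if "0 \<le> t" for t
    unfolding v_def using \<open>\<And>t. 0 \<le> t \<Longrightarrow> convergent (\<lambda>k. u k t)\<close>[OF that]
    by (simp add: convergent_LIMSEQ_iff)
  have v_nonneg: "0 \<le> v t" if "0 \<le> t" for t
    using cone_nonneg[OF uK that] by (intro LIMSEQ_le_const[OF v[OF that]]) auto
  have v_anti: "v t \<le> v s" if "0 \<le> s" "s \<le> t" for s t
    using that cone_antimono[OF uK that] by (intro LIMSEQ_le[OF v v]) auto
  have v_convex: "convex_on {0..} v"
  proof (rule convex_onI)
    fix r s t :: real assume *: "0 < r" "r < 1" "s \<in> {0..}" "t \<in> {0..}"
    then have "0 \<le> (1 - r) *\<^sub>R s + r *\<^sub>R t" by simp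
    moreover have "(\<lambda>k. (1 - r) * u k s + r * u k t) \<longlonglongrightarrow> (1 - r) * v s + r * v t"
      using * by (intro tendsto_intros v) auto
    moreover have "u k ((1 - r) *\<^sub>R s + r *\<^sub>R t) \<le> (1 - r) * u k s + r * u k t" for k
      using * by (intro convex_onD[OF cone_convex[OF uK]]) auto
    ultimately show "v ((1 - r) *\<^sub>R s + r *\<^sub>R t) \<le> (1 - r) * v s + r * v t"
      by (intro LIMSEQ_le[OF v]) auto
  qed simp
  \<comment> \<open>the limit inherits the bound \<open>R\<close>, so it cannot stay above a positive level\<close>
  have v_vanishing: "\<exists>t\<ge>0. v t < e" if "0 < e" for e
  proof (rule ccontr)
    assume "\<not> ?thesis"
    define t where "t = R / e\<^sup>2 + 1"
    have "0 < t" using \<open>0 < R\<close> that by (simp add: t_def add_pos_pos)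
    with \<open>\<not> ?thesis\<close> have "e \<le> v t" by (meson less_imp_le not_le)
    have "t * (v t)\<^sup>2 \<le> R"
    proof (rule LIMSEQ_le_const2)
      show "(\<lambda>k. t * (u k t)\<^sup>2) \<longlonglongrightarrow> t * (v t)\<^sup>2"
        using \<open>0 < t\<close> by (intro tendsto_intros v) simp
      have "t * (u k t)\<^sup>2 \<le> R" for k
      proof -
        have "1 / real (Suc k) \<le> 1" by simp
        with uQ[of k] \<open>m \<le> 0\<close> have "?Q (u k) \<le> 1" by linarith
        then have "halfline_inner (u k) (u k) \<le> R" using coercive[OF uK[of k]] by (simp add: R_def)
        then show ?thesis using cone_square_value_le_inner[OF uK[of k], of t] \<open>0 < t\<close> by simp
      qed
      then show "\<exists>N. \<forall>k\<ge>N. t * (u k t)\<^sup>2 \<le> R" by blast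
    qed
    moreover have "t * e\<^sup>2 \<le> t * (v t)\<^sup>2"
      using \<open>e \<le> v t\<close> that \<open>0 < t\<close> by (intro mult_left_mono power_mono) auto
    moreover have "t * e\<^sup>2 = R + e\<^sup>2" using that by (simp add: t_def field_simps)
    moreover have "0 < e\<^sup>2" using that by simp
    ultimately show False by linarith
  qed
  from polygonal_minorant[OF v_convex v_anti v_nonneg v_vanishing \<open>finite P\<close> a \<open>0 < a\<close> order_refl]
  obtain w where wK: "w \<in> convex_cone_K" and wv: "\<forall>t\<ge>0. w t \<le> v t" and wP: "\<forall>p\<in>P. w p = v p"
    by blast
  have "halfline_inner w w \<le> 2 * (m + 0 + empirical_mean n x w)"
  proof (rule inner_le_of_pointwise_limit[OF uK wK v])
    have "(\<lambda>k. empirical_mean n x (u k)) \<longlonglongrightarrow> empirical_mean n x v"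
      unfolding empirical_mean_def using n by (intro tendsto_intros v) auto
    moreover have "empirical_mean n x v = empirical_mean n x w"
      using wP by (simp add: empirical_mean_def P_def)
    ultimately show "(\<lambda>k. 2 * (m + 1 / real (Suc k) + empirical_mean n x (u k)))
        \<longlonglongrightarrow> 2 * (m + 0 + empirical_mean n x w)"
      by (intro tendsto_intros LIMSEQ_Suc[OF lim_1_over_n]) auto
    show "halfline_inner (u k) (u k) \<le> 2 * (m + 1 / real (Suc k) + empirical_mean n x (u k))" for k
      using uQ[of k] by (simp add: ls_criterion_eq[OF n uK])
  qed (use wv in auto)
  then have "?Q w \<le> m" by (simp add: ls_criterion_eq[OF n wK])
  then have "is_lse n x w" using wK m by (force simp: is_lse_def)
  then show ?thesis by blast
qed

section \<open>Measurability of the test statistic\<close>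

text \<open>By \<open>lse_distance\<close> and the common Lipschitz bound away from \<open>0\<close>, the value of the
  estimator at a point depends continuously on the observations.\<close>

lemma lse_stability:
  assumes n: "0 < n" and f: "is_lse n x f" and g: "is_lse n y g" and "0 < b" "b \<le> t"
    and sign: "\<And>i. i < n \<Longrightarrow> 0 \<le> x i \<longleftrightarrow> 0 \<le> y i"
    and away: "\<And>i. i < n \<Longrightarrow> 0 \<le> x i \<Longrightarrow> b \<le> x i \<and> b \<le> y i"
  shows "\<bar>f t - g t\<bar> ^ 3 \<le> 512 / b ^ 4 * (\<Sum>i<n. \<bar>x i - y i\<bar>)"
proof -
  define D where "D = (\<Sum>i<n. \<bar>x i - y i\<bar>)"
  have K: "f \<in> convex_cone_K" "g \<in> convex_cone_K" using f g by (auto intro: is_lse_cone)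
  have same: "{i. i < n \<and> 0 \<le> y i} = {i. i < n \<and> 0 \<le> x i}" using sign by auto
  have mean: "\<bar>empirical_mean n x h - empirical_mean n y h\<bar> \<le> 4 / b\<^sup>2 * D"
    if h: "is_lse n z h" for z h
  proof -
    have "empirical_mean n x h - empirical_mean n y h
        = (\<Sum>i | i < n \<and> 0 \<le> x i. h (x i) - h (y i)) / real n"
      unfolding empirical_mean_def same by (simp add: sum_subtractf diff_divide_distrib)
    also have "\<bar>\<dots>\<bar> = \<bar>\<Sum>i | i < n \<and> 0 \<le> x i. h (x i) - h (y i)\<bar> / real n" by simp
    also have "\<dots> \<le> \<bar>\<Sum>i | i < n \<and> 0 \<le> x i. h (x i) - h (y i)\<bar> / 1"
      using n by (intro divide_left_mono) auto
    also have "\<dots> \<le> (\<Sum>i | i < n \<and> 0 \<le> x i. \<bar>h (x i) - h (y i)\<bar>)" by simp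
    also have "\<dots> \<le> (\<Sum>i | i < n \<and> 0 \<le> x i. 4 / b\<^sup>2 * \<bar>x i - y i\<bar>)"
      using away by (intro sum_mono lse_Lipschitz[OF n h \<open>0 < b\<close>]) auto
    also have "\<dots> \<le> (\<Sum>i<n. 4 / b\<^sup>2 * \<bar>x i - y i\<bar>)"
      by (intro sum_mono2) auto
    finally show ?thesis by (simp add: D_def sum_distrib_left)
  qed
  have "\<bar>f t - g t\<bar> ^ 3 \<le> 8 * (8 / b\<^sup>2) * (LINT s:{0..}|lborel. (f s - g s)\<^sup>2)"
  proof (rule cube_le_of_Lipschitz)
    fix s assume "t \<le> s"
    then have "\<bar>f s - f t\<bar> \<le> 4 / b\<^sup>2 * (s - t)" "\<bar>g s - g t\<bar> \<le> 4 / b\<^sup>2 * (s - t)"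
      using lse_Lipschitz[OF n f \<open>0 < b\<close>, of t s] lse_Lipschitz[OF n g \<open>0 < b\<close>, of t s] \<open>b \<le> t\<close>
      by auto
    moreover have "8 / b\<^sup>2 * (s - t) = 4 / b\<^sup>2 * (s - t) + 4 / b\<^sup>2 * (s - t)" by argo
    ultimately show "\<bar>f s - g s - (f t - g t)\<bar> \<le> 8 / b\<^sup>2 * (s - t)" by linarith
  qed (use \<open>0 < b\<close> \<open>b \<le> t\<close> cone_diff_square_integrable[OF K] in auto)
  also have "\<dots> \<le> 8 * (8 / b\<^sup>2) * (2 * (4 / b\<^sup>2 * D))"
    using lse_distance[OF n f g] mean[OF f] mean[OF g] by (intro mult_left_mono) auto
  also have "\<dots> = 512 / b ^ 4 * D" by (simp add: power2_eq_square power4_eq_xxxx)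
  finally show ?thesis by (simp add: D_def)
qed

lemma continuous_on_convex_lse:
  assumes n: "0 < n" and "0 < t"
  shows "continuous_on {x. \<forall>i<n. x i \<noteq> 0} (\<lambda>x. convex_lse n x t)"
  unfolding continuous_on_def
proof (rule ballI)
  let ?S = "{x::nat \<Rightarrow> real. \<forall>i<n. x i \<noteq> 0}"
  fix y assume y: "y \<in> ?S"
  have lse: "is_lse n x (convex_lse n x)" if "x \<in> ?S" for x
    using lse_exists[OF n, of x] that is_lse_convex_lse by auto
  \<comment> \<open>within distance \<open>b\<close> of \<open>y\<close> the observations keep their sign and their distance \<open>b\<close> from \<open>0\<close>\<close>
  define a where "a = Min (insert t ((\<lambda>i. \<bar>y i\<bar>) ` {..<n}))"
  have a: "0 < a" "a \<le> t" "\<And>i. i < n \<Longrightarrow> a \<le> \<bar>y i\<bar>"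
    using y \<open>0 < t\<close> by (auto simp: a_def)
  define b where "b = a / 2"
  have b: "0 < b" "b \<le> t" using a by (auto simp: b_def)
  have coord: "((\<lambda>x. x i) \<longlongrightarrow> y i) (at y within ?S)" for i
    using continuous_on_product_coordinates[of i]
    by (auto simp: continuous_on_def intro: tendsto_within_subset)
  have near: "\<forall>\<^sub>F x in at y within ?S. \<forall>i\<in>{..<n}. dist (x i) (y i) < b"
    using tendstoD[OF coord b(1)] by (intro eventually_ball_finite) auto
  have "((\<lambda>x. 512 / b ^ 4 * (\<Sum>i<n. \<bar>x i - y i\<bar>)) \<longlongrightarrow> 512 / b ^ 4 * (\<Sum>i<n. \<bar>y i - y i\<bar>))
      (at y within ?S)"
    by (intro tendsto_intros coord)
  then have sum: "((\<lambda>x. 512 / b ^ 4 * (\<Sum>i<n. \<bar>x i - y i\<bar>)) \<longlongrightarrow> 0) (at y within ?S)" by simp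
  show "((\<lambda>x. convex_lse n x t) \<longlongrightarrow> convex_lse n y t) (at y within ?S)"
  proof (rule tendstoI)
    fix e :: real assume "0 < e"
    then have "\<forall>\<^sub>F x in at y within ?S. 512 / b ^ 4 * (\<Sum>i<n. \<bar>x i - y i\<bar>) < e ^ 3"
      using order_tendstoD(2)[OF sum, of "e ^ 3"] by simp
    moreover have "\<forall>\<^sub>F x in at y within ?S. x \<in> ?S" by (simp add: eventually_at_filter)
    ultimately show "\<forall>\<^sub>F x in at y within ?S. dist (convex_lse n x t) (convex_lse n y t) < e"
      using near
    proof eventually_elim
      case (elim x)
      have close: "\<bar>x i - y i\<bar> < b" if "i < n" for i using elim(3) that by (simp add: dist_real_def)
      have "\<bar>convex_lse n x t - convex_lse n y t\<bar> ^ 3 \<le> 512 / b ^ 4 * (\<Sum>i<n. \<bar>x i - y i\<bar>)"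
      proof (rule lse_stability[OF n lse lse b])
        fix i assume "i < n"
        then show "0 \<le> x i \<longleftrightarrow> 0 \<le> y i" "0 \<le> x i \<Longrightarrow> b \<le> x i \<and> b \<le> y i"
          using close[of i] a(3)[of i] a(1) unfolding b_def by (auto simp: abs_if split: if_splits)
      qed (use elim y in auto)
      also note elim(1)
      finally show ?case
        using \<open>0 < e\<close> by (simp add: dist_real_def power_less_imp_less_base)
    qed
  qed
qed

lemma test_statistic_gt_iff:
  assumes n: "0 < n" and f: "is_lse n x (convex_lse n x)"
  shows "q < test_statistic n x \<longleftrightarrow>
    (\<exists>t\<ge>0. q / sqrt (real n) < triangular_density t - convex_lse n x t)"
proof -
  let ?h = "\<lambda>t. triangular_density t - convex_lse n x t"
  have "bdd_above (?h ` {0..})"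
  proof (rule bdd_aboveI2)
    fix t :: real assume "t \<in> {0..}"
    then show "?h t \<le> 2"
      using cone_nonneg[OF is_lse_cone[OF f], of t]
      by (auto simp: triangular_density_def indicator_def)
  qed
  then have "q / sqrt (real n) < (SUP t\<in>{0..}. ?h t) \<longleftrightarrow> (\<exists>t\<in>{0..}. q / sqrt (real n) < ?h t)"
    by (intro less_cSUP_iff) auto
  then show ?thesis
    using n by (auto simp: test_statistic_def pos_divide_less_eq mult.commute)
qed

text \<open>The point \<open>0\<close> has to be excluded for measurability, because the value of the estimator at \<open>0\<close>
  is not controlled by the Lipschitz bounds.\<close>

lemma test_statistic_gt_iff_positive:
  assumes n: "0 < n" and f: "is_lse n x (convex_lse n x)"
  shows "q < test_statistic n x \<longleftrightarrow>
    (\<exists>t>0. q / sqrt (real n) < triangular_density t - convex_lse n x t)"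
proof -
  let ?h = "\<lambda>t. triangular_density t - convex_lse n x t"
  have "\<exists>t>0. q / sqrt (real n) < ?h t" if "q / sqrt (real n) < ?h 0"
  proof -
    have "continuous_on {0..} ?h"
      by (intro continuous_on_diff cone_continuous is_lse_cone[OF f] cone_triangular)
    then have "(?h \<longlongrightarrow> ?h 0) (at 0 within {0..})" by (simp add: continuous_on_def)
    then have "(?h \<longlongrightarrow> ?h 0) (at_right 0)" by (rule tendsto_within_subset) auto
    then have "\<forall>\<^sub>F s in at_right 0. q / sqrt (real n) < ?h s"
      using that by (rule order_tendstoD(1))
    then have "\<forall>\<^sub>F s in at_right 0. 0 < s \<and> q / sqrt (real n) < ?h s"
      by (intro eventually_conj) (auto simp: eventually_at_right_less)
    then show ?thesis using eventually_happens'[OF trivial_limit_at_right_real] by blast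
  qed
  then have "(\<exists>t\<ge>0. q / sqrt (real n) < ?h t) \<longleftrightarrow> (\<exists>t>0. q / sqrt (real n) < ?h t)"
    by (metis less_eq_real_def)
  with test_statistic_gt_iff[OF n f] show ?thesis by simp
qed

text \<open>Where some observation vanishes there is no estimator, and the choice made by
  \<^const>\<open>convex_lse\<close> does not depend on the observations; so the two cases can be treated separately.\<close>

lemma test_statistic_borel:
  assumes n: "0 < n"
  shows "{x. q < test_statistic n x} \<in> sets borel"
proof -
  let ?S = "{x::nat \<Rightarrow> real. \<forall>i<n. x i \<noteq> 0}"
  have open_S: "open ?S"
  proof -
    have "?S = (\<Inter>i\<in>{..<n}. (\<lambda>x. x i) -` (- {0}))" by auto
    also have "open \<dots>"
      by (intro open_INT ballI open_vimage continuous_on_product_coordinates) auto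
    finally show ?thesis .
  qed
  let ?A = "\<Union>t\<in>{0<..}. (\<lambda>x. convex_lse n x t) -` {..<triangular_density t - q / sqrt (real n)} \<inter> ?S"
  define C where "C = sqrt (real n) * (SUP t\<in>{0..}. triangular_density t - (SOME f::real \<Rightarrow> real. False) t)"
  have "x \<in> {x. q < test_statistic n x} \<longleftrightarrow> x \<in> ?A \<union> (if q < C then - ?S else {})" for x
  proof (cases "x \<in> ?S")
    case True
    then have "is_lse n x (convex_lse n x)" using lse_exists[OF n, of x] is_lse_convex_lse by auto
    then show ?thesis using True test_statistic_gt_iff_positive[OF n, of x q] by force
  next
    case False
    then have "is_lse n x f \<longleftrightarrow> False" for f using no_lse_if_observation_0[OF n] by auto
    then have "test_statistic n x = C" by (simp add: test_statistic_def convex_lse_eq C_def)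
    then show ?thesis using False by auto
  qed
  then have "{x. q < test_statistic n x} = ?A \<union> (if q < C then - ?S else {})" by blast
  moreover have "open ?A"
    using continuous_on_convex_lse[OF n]
    by (intro open_UN ballI) (auto simp: continuous_on_open_vimage[OF open_S])
  moreover have "closed (- ?S)" by (rule closed_Compl[OF open_S])
  ultimately show ?thesis by auto
qed

section \<open>Consistency of the test\<close>

text \<open>The difference is Lipschitz to the right of the point \<open>t\<close>, so \<open>cube_le_of_Lipschitz\<close> bounds
  the integral from below.\<close>

lemma integral_diff_square_pos:
  assumes f: "f \<in> convex_cone_K" and g: "g \<in> convex_cone_K" and "0 < t" "f t \<noteq> g t"
  shows "0 < (LINT s:{0..}|lborel. (f s - g s)\<^sup>2)"
proof -
  define L where "L = 2 * f (t / 2) / t + 2 * g (t / 2) / t + 1"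
  have "0 \<le> f (t / 2)" "0 \<le> g (t / 2)" using cone_nonneg[OF f] cone_nonneg[OF g] \<open>0 < t\<close> by auto
  then have "0 < L" using \<open>0 < t\<close> by (simp add: L_def add_nonneg_pos)
  have "\<bar>f t - g t\<bar> ^ 3 \<le> 8 * L * (LINT s:{0..}|lborel. (f s - g s)\<^sup>2)"
  proof (rule cube_le_of_Lipschitz)
    fix s assume "t \<le> s"
    then have "\<bar>f s - f t\<bar> \<le> 2 * f (t / 2) / t * (s - t)" "\<bar>g s - g t\<bar> \<le> 2 * g (t / 2) / t * (s - t)"
      using cone_Lipschitz[OF f \<open>0 < t\<close> order_refl] cone_Lipschitz[OF g \<open>0 < t\<close> order_refl] by auto
    moreover have "L * (s - t)
        = 2 * f (t / 2) / t * (s - t) + 2 * g (t / 2) / t * (s - t) + (s - t)"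
      by (simp add: L_def distrib_right)
    ultimately show "\<bar>f s - g s - (f t - g t)\<bar> \<le> L * (s - t)" using \<open>t \<le> s\<close> by linarith
  qed (use \<open>0 < L\<close> \<open>0 < t\<close> cone_diff_square_integrable[OF f g] in auto)
  moreover have "0 < \<bar>f t - g t\<bar> ^ 3" using \<open>f t \<noteq> g t\<close> by simp
  ultimately have "0 < 8 * L * (LINT s:{0..}|lborel. (f s - g s)\<^sup>2)" by linarith
  then show ?thesis using \<open>0 < L\<close> by (simp add: zero_less_mult_iff)
qed

text \<open>With \<open>p\<close> for the triangular density, the bound in \<open>lse_near_triangular\<close> is the expectation of
  \<open>f0 - p\<close> under the density \<open>f0\<close>, minus the squared distance \<open>D\<close> of \<open>f0\<close> and \<open>p\<close>, plus an error
  of at most \<open>D / 2\<close>. An empirical mean less than \<open>D / 2\<close> below its expectation violates it.\<close>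

lemma lse_falls_short:
  fixes f0 :: "real \<Rightarrow> real"
  defines "D \<equiv> (LINT t:{0..}|lborel. (f0 t - triangular_density t)\<^sup>2)"
  assumes n: "0 < n" and f: "is_lse n x f" and f0: "f0 \<in> convex_cone_K"
    and d: "0 < d" "d \<le> 1" "(f0 0 + 7) * d \<le> D / 2"
    and mean: "halfline_inner f0 f0 - halfline_inner triangular_density f0 - D / 2
      < empirical_mean n x (\<lambda>t. f0 t - triangular_density t)"
  shows "\<exists>t\<ge>0. d\<^sup>2 < triangular_density t - f t"
proof (rule ccontr)
  assume "\<not> ?thesis"
  then have "triangular_density t - d\<^sup>2 \<le> f t" if "0 \<le> t" for t using that by force
  from lse_near_triangular[OF n f f0 d(1,2) this]
  have "empirical_mean n x (\<lambda>t. f0 t - triangular_density t)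
    \<le> halfline_inner triangular_density f0 - halfline_inner triangular_density triangular_density + D / 2"
    using d(3) by linarith
  moreover have "D = halfline_inner f0 f0 - 2 * halfline_inner triangular_density f0
      + halfline_inner triangular_density triangular_density"
    unfolding D_def integral_diff_square[OF f0 cone_triangular] inner_commute[of f0 triangular_density] ..
  ultimately show False using mean by argo
qed

theorem theorem2p9:
  fixes M :: "'a measure" and X :: "nat \<Rightarrow> 'a \<Rightarrow> real" and f0 :: "real \<Rightarrow> real"
    and N :: "'b measure" and U :: "real \<Rightarrow> 'b \<Rightarrow> real" and T :: "'b \<Rightarrow> real"
    and \<alpha> :: real
  assumes "prob_space M"
    and "f0 \<in> convex_cone_K" and "(LINT t:{0..}|lborel. f0 t) = 1"
    and "\<exists>t>0. f0 t \<noteq> triangular_density t"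
    and "prob_space.indep_vars M (\<lambda>_. borel) X UNIV"
    and "\<And>i. distributed M lborel (X i) (\<lambda>t. ennreal (f0 t * indicator {0..} t))"
    and "brownian_bridge N U" and "limit_variable N U T"
    and "0 < \<alpha>" and "\<alpha> < 1"
  shows "(\<lambda>n. measure M {\<omega> \<in> space M.
            test_statistic n (\<lambda>i. X i \<omega>) > upper_quantile N T \<alpha>}) \<longlonglongrightarrow> 1"
proof -
  interpret prob_space M by fact
  note f0 = assms(2) and indep = assms(5) and dist = assms(6)
  define q where "q = upper_quantile N T \<alpha>"
  let ?p = triangular_density
  have X_meas [measurable]: "X i \<in> borel_measurable M" for i
    using distributed_measurable[OF dist[of i]] by simp
  define D where "D = (LINT t:{0..}|lborel. (f0 t - ?p t)\<^sup>2)"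
  have "0 < D" using assms(4) integral_diff_square_pos[OF f0 cone_triangular] by (auto simp: D_def)
  have f00: "0 \<le> f0 0" using cone_nonneg[OF f0] by simp
  \<comment> \<open>the estimator will fall short by \<open>d\<^sup>2\<close>; this choice makes the error term of
    \<open>lse_near_triangular\<close> at most half of the squared distance \<open>D\<close>\<close>
  define d where "d = min 1 (D / (2 * (f0 0 + 7)))"
  have d: "0 < d" "d \<le> 1" "(f0 0 + 7) * d \<le> D / 2"
  proof -
    show "0 < d" using \<open>0 < D\<close> f00 by (simp add: d_def)
    have "(f0 0 + 7) * d \<le> (f0 0 + 7) * (D / (2 * (f0 0 + 7)))"
      using f00 by (intro mult_left_mono) (auto simp: d_def)
    also have "\<dots> = D / 2" using f00 by (simp add: field_simps)
    finally show "(f0 0 + 7) * d \<le> D / 2" .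
  qed (simp add: d_def)
  define \<psi> where "\<psi> t = indicator {0..} t *\<^sub>R (f0 t - ?p t)" for t
  have \<psi>_meas [measurable]: "\<psi> \<in> borel_measurable borel"
  proof -
    have "continuous_on {0..} (\<lambda>t. f0 t - ?p t)"
      by (intro continuous_intros cone_continuous f0 cone_triangular)
    from set_borel_measurable_continuous_halfline[OF this] show ?thesis
      by (simp add: \<psi>_def[abs_def] set_borel_measurable_def)
  qed
  define B where "B = f0 0 + 2"
  have "0 < B" using f00 by (simp add: B_def)
  have \<psi>_bound: "\<psi> t \<in> {- B..B}" for t
  proof (cases "0 \<le> t")
    case True
    then have "0 \<le> f0 t" "f0 t \<le> f0 0" "0 \<le> ?p t" "?p t \<le> 2"
      using cone_nonneg[OF f0] cone_le_value_0[OF f0]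
      by (auto simp: triangular_density_def indicator_def)
    then show ?thesis using True f00 by (simp add: \<psi>_def B_def)
  qed (use \<open>0 < B\<close> in \<open>simp add: \<psi>_def\<close>)
  define \<mu> where "\<mu> = halfline_inner f0 f0 - halfline_inner ?p f0"
  have \<psi>_mean: "expectation (\<lambda>\<omega>. \<psi> (X i \<omega>)) = \<mu>" for i
  proof -
    have "expectation (\<lambda>\<omega>. \<psi> (X i \<omega>)) = (\<integral>t. f0 t * indicator {0..} t * \<psi> t \<partial>lborel)"
      using cone_nonneg[OF f0]
      by (intro distributed_integral[OF dist, symmetric]) (auto simp: indicator_def)
    also have "\<dots> = (LINT t:{0..}|lborel. f0 t * f0 t - ?p t * f0 t)"
      unfolding set_lebesgue_integral_def
      by (intro Bochner_Integration.integral_cong) (auto simp: \<psi>_def indicator_def algebra_simps)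
    also have "\<dots> = \<mu>"
      unfolding \<mu>_def halfline_inner_def
      by (intro set_integral_diff cone_product_integrable f0 cone_triangular)
    finally show ?thesis .
  qed
  have "AE \<omega> in M. 0 < X i \<omega>" for i
  proof -
    have "AE t in lborel. 0 < ennreal (f0 t * indicator {0..} t) \<longrightarrow> 0 < t"
      using AE_lborel_singleton[of "0::real"] by eventually_elim (auto simp: indicator_def)
    then show ?thesis by (subst distributed_AE2[OF dist]) auto
  qed
  then have pos: "AE \<omega> in M. \<forall>i<n. 0 < X i \<omega>" for n
    by (simp add: AE_all_countable)
  \<comment> \<open>the event that the empirical mean of \<open>\<psi>\<close> is within \<open>D / 2\<close> below its expectation, the
    tolerance allowed by \<open>lse_falls_short\<close>\<close>
  define good where "good n = {\<omega> \<in> space M. real n * \<mu> - real n * (D / 2) < (\<Sum>i<n. \<psi> (X i \<omega>))}" for n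
  have good_sets [measurable]: "good n \<in> sets M" for n unfolding good_def by measurable
  have event_sets: "{\<omega> \<in> space M. q < test_statistic n (\<lambda>i. X i \<omega>)} \<in> sets M" if "0 < n" for n
  proof -
    have "(\<lambda>\<omega> i. X i \<omega>) \<in> measurable M borel"
      by (rule measurable_coordinatewise_then_product) simp
    from measurable_sets[OF this test_statistic_borel[OF that, of q]]
    show ?thesis by (simp add: vimage_def Int_def conj_commute)
  qed
  have good_prob: "1 - exp (- (D\<^sup>2 / (8 * B\<^sup>2)) * real n) \<le> prob (good n)" if "0 < n" for n
  proof -
    have "indep_vars (\<lambda>_. borel) (\<lambda>i. \<psi> \<circ> X i) {..<n}"
      by (intro indep_vars_compose[OF indep_vars_subset[OF indep]]) auto
    then have ind: "indep_vars (\<lambda>_. borel) (\<lambda>i \<omega>. \<psi> (X i \<omega>)) {..<n}" by (simp add: comp_def)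
    interpret H: Hoeffding_ineq M "{..<n}" "\<lambda>i \<omega>. \<psi> (X i \<omega>)" "\<lambda>_. - B" "\<lambda>_. B" "real n * \<mu>"
      using ind \<psi>_bound by unfold_locales (auto simp: \<psi>_mean)
    have "prob (space M - good n) = prob {\<omega> \<in> space M. (\<Sum>i<n. \<psi> (X i \<omega>)) \<le> real n * \<mu> - real n * (D / 2)}"
      by (intro arg_cong[where f = prob]) (auto simp: good_def)
    also have "\<dots> \<le> exp (- 2 * (real n * (D / 2))\<^sup>2 / (\<Sum>i<n. (B - (- B))\<^sup>2))"
      using \<open>0 < D\<close> \<open>0 < B\<close> that by (intro H.Hoeffding_ineq_le) auto
    also have "- 2 * (real n * (D / 2))\<^sup>2 / (\<Sum>i<n. (B - (- B))\<^sup>2) = - (D\<^sup>2 / (8 * B\<^sup>2)) * real n"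
      using that \<open>0 < B\<close> by (simp add: field_simps power2_eq_square)
    finally show ?thesis using prob_compl[OF good_sets[of n]] by simp
  qed
  \<comment> \<open>from \<open>n0\<close> on, the shortfall \<open>d\<^sup>2\<close> multiplied by \<open>sqrt n\<close> exceeds the critical value\<close>
  obtain n0 :: nat where n0: "(q / d\<^sup>2)\<^sup>2 < real n0" using reals_Archimedean2 by blast
  have large: "q < test_statistic n (\<lambda>i. X i \<omega>)"
    if n: "n0 \<le> n" "0 < n" and \<omega>: "\<omega> \<in> good n" "\<forall>i<n. 0 < X i \<omega>" for n \<omega>
  proof -
    let ?x = "\<lambda>i. X i \<omega>"
    have lse: "is_lse n ?x (convex_lse n ?x)"
      using lse_exists[OF n(2), of ?x] \<omega>(2) is_lse_convex_lse by (metis less_irrefl)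
    have "(\<Sum>i<n. \<psi> (X i \<omega>)) = (\<Sum>i | i < n \<and> 0 \<le> X i \<omega>. f0 (X i \<omega>) - ?p (X i \<omega>))"
      using \<omega>(2) by (intro sum.cong) (auto simp: \<psi>_def less_imp_le)
    then have "empirical_mean n ?x (\<lambda>t. f0 t - ?p t) = (\<Sum>i<n. \<psi> (X i \<omega>)) / real n"
      by (simp add: empirical_mean_def)
    moreover have "real n * (\<mu> - D / 2) < (\<Sum>i<n. \<psi> (X i \<omega>))"
      using \<omega>(1) by (simp add: good_def right_diff_distrib)
    ultimately have "\<mu> - D / 2 < empirical_mean n ?x (\<lambda>t. f0 t - ?p t)"
      using n by (simp add: pos_less_divide_eq mult.commute)
    then obtain t where t: "0 \<le> t" "d\<^sup>2 < ?p t - convex_lse n ?x t"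
      using lse_falls_short[OF n(2) lse f0 d(1,2)] d(3) unfolding D_def \<mu>_def by blast
    have "(q / d\<^sup>2)\<^sup>2 \<le> real n" using n0 n(1) by linarith
    then have "q / d\<^sup>2 \<le> sqrt (real n)" by (rule real_le_rsqrt)
    then have "q / sqrt (real n) \<le> d\<^sup>2"
      using n d(1) by (simp add: field_simps)
    then have "q / sqrt (real n) < ?p t - convex_lse n ?x t" using t(2) by linarith
    with t(1) show ?thesis unfolding test_statistic_gt_iff[OF n(2) lse] by blast
  qed
  have lower: "1 - exp (- (D\<^sup>2 / (8 * B\<^sup>2)) * real n)
      \<le> prob {\<omega> \<in> space M. q < test_statistic n (\<lambda>i. X i \<omega>)}" if n: "n0 \<le> n" "0 < n" for n
  proof -
    have "prob (good n) \<le> prob {\<omega> \<in> space M. q < test_statistic n (\<lambda>i. X i \<omega>)}"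
    proof (rule finite_measure_mono_AE)
      show "AE \<omega> in M. \<omega> \<in> good n \<longrightarrow> \<omega> \<in> {\<omega> \<in> space M. q < test_statistic n (\<lambda>i. X i \<omega>)}"
      proof (rule eventually_mono[OF pos[of n]], rule impI)
        fix \<omega> assume \<omega>: "\<forall>i<n. 0 < X i \<omega>" "\<omega> \<in> good n"
        have "\<omega> \<in> space M" using \<omega>(2) by (simp add: good_def)
        then show "\<omega> \<in> {\<omega> \<in> space M. q < test_statistic n (\<lambda>i. X i \<omega>)}"
          using large[OF n \<omega>(2,1)] by simp
      qed
    qed (rule event_sets[OF n(2)])
    with good_prob[OF n(2)] show ?thesis by linarith
  qed
  have "(\<lambda>n. 1 - exp (- (D\<^sup>2 / (8 * B\<^sup>2)) * real n)) \<longlonglongrightarrow> 1 - 0"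
  proof (intro tendsto_diff tendsto_const filterlim_compose[OF exp_at_bot])
    show "filterlim (\<lambda>n. - (D\<^sup>2 / (8 * B\<^sup>2)) * real n) at_bot sequentially"
      using \<open>0 < D\<close> \<open>0 < B\<close>
      by (intro filterlim_tendsto_neg_mult_at_bot[OF tendsto_const]) (auto intro: filterlim_real_sequentially)
  qed
  then have lim: "(\<lambda>n. 1 - exp (- (D\<^sup>2 / (8 * B\<^sup>2)) * real n)) \<longlonglongrightarrow> 1" by simp
  have "(\<lambda>n. prob {\<omega> \<in> space M. q < test_statistic n (\<lambda>i. X i \<omega>)}) \<longlonglongrightarrow> 1"
  proof (rule tendsto_sandwich[OF _ _ lim tendsto_const])
    show "\<forall>\<^sub>F n in sequentially. 1 - exp (- (D\<^sup>2 / (8 * B\<^sup>2)) * real n)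
        \<le> prob {\<omega> \<in> space M. q < test_statistic n (\<lambda>i. X i \<omega>)}"
      using lower by (intro eventually_sequentiallyI[of "max n0 1"]) auto
  qed (simp add: prob_le_1)
  then show ?thesis by (simp add: q_def)
qed

end
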